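(* Let $G$ be a second countable compactly generated locally compact group. The following are equivalent. 1. $G$ is ADS. 2. $G$ is ALS. 3. $G$ is uniformly ALS. 4. $G$ is ALSS.
   Context: $G$ is compactly generated if it has a compact generating set. A lattice in a locally compact group $G$ is a discrete subgroup $\Gamma$ such that $G/\Gamma$ has a bounded (nonzero) $G$-invariant Borel measure. A fundamental domain for a discrete subgroup $\Gamma$ is a Borel subset $X\subset G$ with $X\Gamma=G$ and $X\gamma\cap X\gamma'=\emptyset$ for distinct $\gamma,\gamma'\in\Gamma$. The Chabauty–Fell topology on the set of closed subsets of $G$ has as a basis the finite intersections of sets of the form $\{F: F\cap K=\emptyset\}$ ($K$ compact) and $\{F: F\cap U\ne\emptyset\}$ ($U$ open). Definitions, for a second countable locally compact group $G$: - ADS: there is a sequence $(\Gamma_j)$ of discrete subgroups such that for any non-empty open $O\subset G$ there is $j_0$ with $O\cap\Gamma_j\neq\emptyset$ for all $j\ge j_0$ (equivalently, $(\Gamma_j)$ converges to $G$ in the Chabauty–Fell topology). - ALS: there is a sequence $(\Gamma_j)$ of lattices in $G$ converging to $G$ for the Chabauty–Fell topology. - Uniformly ALS: there are a sequence $(\Gamma_j)$ of lattice subgroups and a right invariant metric $\mathrm{dist}$ generating the topology of $G$ such that for any $\varepsilon>0$ there is $j_0$ such that for all $j\ge j_0$ and all $s\in G$ there is $\gamma_j\in\Gamma_j$ with $\mathrm{dist}(s,\gamma_j)<\varepsilon$. - ALSS: there are a sequence $(\Gamma_j)_{j\ge1}$ of lattice subgroups and associated fundamental domains $(X_j)$ such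 that for any neighborhood $V$ of the identity $e_G$ there is $j_0$ with $X_j\subset V$ for all $j\ge j_0$. *)

theory Defs
  imports "HOL-Analysis.Analysis"
begin

text \<open>
  Topological groups are rendered by the (non-commutative) type class
  \<^class>\<open>topological_group_add\<close>. The group law is therefore written additively:
  the product \<open>g h\<close> is \<open>g + h\<close>, the identity is \<open>0\<close>, the inverse of \<open>g\<close> is \<open>- g\<close>,
  and the left coset \<open>g H\<close> is \<open>g +o H\<close>. No commutativity is assumed anywhere.
\<close>

definition is_subgroup :: "'a::group_add set \<Rightarrow> bool" where
  "is_subgroup H \<longleftrightarrow> 0 \<in> H \<and> (\<forall>x\<in>H. \<forall>y\<in>H. x + y \<in> H) \<and> (\<forall>x\<in>H. - x \<in> H)"

definition discrete_subgroup :: "'a::topological_group_add set \<Rightarrow> bool" where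
  "discrete_subgroup H \<longleftrightarrow> is_subgroup H \<and> discrete H"

definition compactly_generated :: "'a::topological_group_add itself \<Rightarrow> bool" where
  "compactly_generated _ \<longleftrightarrow> (\<exists>K::'a set. compact K \<and> is_subgroup hull K = UNIV)"

text \<open>The space \<open>G/H\<close> of left cosets with the quotient topology.\<close>

definition coset_space :: "'a::topological_group_add set \<Rightarrow> 'a set topology" where
  "coset_space H = topology (\<lambda>U. U \<subseteq> range (\<lambda>g. g +o H) \<and> open {g. g +o H \<in> U})"

lemma openin_coset_space:
  "openin (coset_space H) U \<longleftrightarrow> U \<subseteq> range (\<lambda>g. g +o H) \<and> open {g. g +o H \<in> U}"
proof -
  have "istopology (\<lambda>U. U \<subseteq> range (\<lambda>g. g +o H) \<and> open {g. g +o H \<in> U})"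
    unfolding istopology_def
  proof (intro conjI allI impI; (elim conjE)?)
    fix S T
    assume "open {g. g +o H \<in> S}" "open {g. g +o H \<in> T}"
    then have "open ({g. g +o H \<in> S} \<inter> {g. g +o H \<in> T})" by blast
    then show "open {g. g +o H \<in> S \<inter> T}" by (simp add: Collect_conj_eq)
  next
    fix K
    assume K: "\<forall>S\<in>K. S \<subseteq> range (\<lambda>g. g +o H) \<and> open {g. g +o H \<in> S}"
    then show "\<Union> K \<subseteq> range (\<lambda>g. g +o H)" by blast
    have "open (\<Union>S\<in>K. {g. g +o H \<in> S})" using K by blast
    moreover have "(\<Union>S\<in>K. {g. g +o H \<in> S}) = {g. g +o H \<in> \<Union> K}" by blast
    ultimately show "open {g. g +o H \<in> \<Union> K}" by simp
  qed blast
  then show ?thesis by (simp add: coset_space_def topology_inverse')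
qed

lemma topspace_coset_space: "topspace (coset_space H) = range (\<lambda>g. g +o H)"
proof
  show "topspace (coset_space H) \<subseteq> range (\<lambda>g. g +o H)"
    unfolding topspace_def openin_coset_space by blast
  have "openin (coset_space H) (range (\<lambda>g. g +o H))"
    unfolding openin_coset_space by simp
  then show "range (\<lambda>g. g +o H) \<subseteq> topspace (coset_space H)"
    by (rule openin_subset)
qed

lemma quotient_map_coset_space: "quotient_map euclidean (coset_space H) (\<lambda>g. g +o H)"
  by (simp add: quotient_map_def topspace_coset_space openin_coset_space)

definition invariant_borel_measure ::
  "'a::topological_group_add set \<Rightarrow> 'a set measure \<Rightarrow> bool" where
  "invariant_borel_measure H M \<longleftrightarrow>
     sets M = sets (sigma (topspace (coset_space H)) {U. openin (coset_space H) U}) \<and>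
     (\<forall>g. \<forall>A\<in>sets M. emeasure M ((\<lambda>C. g +o C) ` A) = emeasure M A)"

definition is_lattice :: "'a::topological_group_add set \<Rightarrow> bool" where
  "is_lattice H \<longleftrightarrow> discrete_subgroup H \<and>
     (\<exists>M. invariant_borel_measure H M \<and> finite_measure M \<and> emeasure M (space M) \<noteq> 0)"

definition fundamental_domain ::
  "'a::topological_group_add set \<Rightarrow> 'a set \<Rightarrow> bool" where
  "fundamental_domain H X \<longleftrightarrow> X \<in> sets borel \<and>
     (\<Union>h\<in>H. (\<lambda>x. x + h) ` X) = UNIV \<and> disjoint_family_on (\<lambda>h. (\<lambda>x. x + h) ` X) H"

text \<open>
  The generating sets with \<open>K = {}\<close> consist of all closed sets, so this is a topology on
  the set of all closed subsets, the empty one included.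
\<close>

definition chabauty_fell :: "'a::topological_space set topology" where
  "chabauty_fell = topology_generated_by
     ({{F. closed F \<and> F \<inter> K = {}} |K. compact K} \<union> {{F. closed F \<and> F \<inter> U \<noteq> {}} |U. open U})"

lemma topspace_chabauty_fell: "topspace chabauty_fell = {F. closed F}"
proof -
  have "{F. closed F} \<in> {{F. closed F \<and> F \<inter> K = {}} |K. compact K}"
    using compact_empty by (intro CollectI exI[of _ "{}"]) simp
  then show ?thesis
    unfolding chabauty_fell_def topology_generated_by_topspace by blast
qed

definition ADS :: "'a::topological_group_add itself \<Rightarrow> bool" where
  "ADS _ \<longleftrightarrow> (\<exists>\<Gamma> :: nat \<Rightarrow> 'a set. (\<forall>j. discrete_subgroup (\<Gamma> j)) \<and>
     (\<forall>U. open U \<and> U \<noteq> {} \<longrightarrow> (\<exists>j0. \<forall>j\<ge>j0. U \<inter> \<Gamma> j \<noteq> {})))"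

definition ALS :: "'a::topological_group_add itself \<Rightarrow> bool" where
  "ALS _ \<longleftrightarrow> (\<exists>\<Gamma> :: nat \<Rightarrow> 'a set. (\<forall>j. is_lattice (\<Gamma> j)) \<and>
     limitin chabauty_fell \<Gamma> UNIV sequentially)"

definition uniformly_ALS :: "'a::topological_group_add itself \<Rightarrow> bool" where
  "uniformly_ALS _ \<longleftrightarrow> (\<exists>(\<Gamma> :: nat \<Rightarrow> 'a set) (d :: 'a \<Rightarrow> 'a \<Rightarrow> real).
     (\<forall>j. is_lattice (\<Gamma> j)) \<and>
     Metric_space UNIV d \<and> Metric_space.mtopology UNIV d = euclidean \<and>
     (\<forall>x y g. d (x + g) (y + g) = d x y) \<and>
     (\<forall>\<epsilon>>0. \<exists>j0. \<forall>j\<ge>j0. \<forall>s. \<exists>\<gamma>\<in>\<Gamma> j. d s \<gamma> < \<epsilon>))"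

definition ALSS :: "'a::topological_group_add itself \<Rightarrow> bool" where
  "ALSS _ \<longleftrightarrow> (\<exists>(\<Gamma> :: nat \<Rightarrow> 'a set) (X :: nat \<Rightarrow> 'a set).
     (\<forall>j. is_lattice (\<Gamma> j)) \<and> (\<forall>j. fundamental_domain (\<Gamma> j) (X j)) \<and>
     (\<forall>V. 0 \<in> interior V \<longrightarrow> (\<exists>j0. \<forall>j\<ge>j0. X j \<subseteq> V)))"

end

theory Submission
  imports Defs
begin

text \<open>
  The three properties ALS, uniformly ALS and ALSS each provide discrete subgroups that come close
  to every point of \<open>G\<close>, so each implies ADS. The content lies in the converse: the discrete
  subgroups \<open>\<Gamma>\<^sub>j\<close> of an approximating sequence are eventually lattices, with arbitrarily small
  fundamental domains.

  Let \<open>V\<close> be a relatively compact open neighbourhood of the identity. Compact generation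
  turns the pointwise approximation into a uniform one: eventually \<open>V + \<Gamma>\<^sub>j = G\<close>
  (\<open>eventually_small_nhd_plus_subgroup\<close>), and then \<open>V\<close> contains a Borel fundamental domain of
  \<open>\<Gamma>\<^sub>j\<close> (\<open>ex_fundamental_domain\<close>).

  For the finite invariant measure on \<open>G/\<Gamma>\<^sub>j\<close>, one needs a measure on \<open>G\<close> that is left invariant
  and also right invariant under \<open>\<Gamma>\<^sub>j\<close>. The approximation itself provides it: the counting measures
  of the \<open>\<Gamma>\<^sub>j\<close>, suitably normalised, have a limit point, and as \<open>\<Gamma>\<^sub>j\<close> acts on its counting
  measure from both sides, the limit is invariant under all left and right translations
  (\<open>ex_biinvariant_measure\<close>). The limit is taken as a set function on compact sets, from which
  a Borel measure results by regularisation and Caratheodory's theorem. Cutting preimages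
  down to a relatively compact fundamental domain then gives the measure on the coset space
  (\<open>is_lattice_of_biinvariant_measure\<close>).

  Lattices with fundamental domains shrinking to the identity yield ALSS at once, and ALS because
  convergence to \<open>G\<close> in the Chabauty--Fell topology means that every nonempty open set is
  eventually met. For uniform ALS there must also be a right invariant metric defining the
  topology (\<open>ex_right_invariant_metric\<close>); right invariance turns a decomposition \<open>s = x + \<gamma>\<close> with
  \<open>x\<close> near \<open>0\<close> into the statement that \<open>s\<close> is near \<open>\<gamma>\<close>, with a bound independent of \<open>s\<close>.
\<close>

section \<open>Translates and neighbourhoods in topological groups\<close>

lemma open_translate_vimage_left:
  fixes g :: "'a::topological_group_add"
  assumes "open U" shows "open {x. g + x \<in> U}"
proof -
  have "open ((\<lambda>x. g + x) -` U)"
    by (intro open_vimage assms continuous_intros)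
  then show ?thesis by (simp add: vimage_def)
qed

lemma open_translate_vimage_right:
  fixes g :: "'a::topological_group_add"
  assumes "open U" shows "open {x. x + g \<in> U}"
proof -
  have "open ((\<lambda>x. x + g) -` U)"
    by (intro open_vimage assms continuous_intros)
  then show ?thesis by (simp add: vimage_def)
qed

lemma open_translate_left:
  fixes g :: "'a::topological_group_add"
  assumes "open U" shows "open ((+) g ` U)"
proof -
  have "(+) g ` U = {x. - g + x \<in> U}"
  proof (intro set_eqI iffI)
    fix x assume "x \<in> {x. - g + x \<in> U}"
    then show "x \<in> (+) g ` U" by (intro image_eqI[of _ _ "- g + x"]) (simp_all add: add.assoc[symmetric])
  qed auto
  then show ?thesis using open_translate_vimage_left[OF assms, of "- g"] by simp
qed

lemma open_translate_right:
  fixes g :: "'a::topological_group_add"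
  assumes "open U" shows "open ((\<lambda>x. x + g) ` U)"
proof -
  have "(\<lambda>x. x + g) ` U = {x. x + - g \<in> U}"
  proof (intro set_eqI iffI)
    fix x assume "x \<in> {x. x + - g \<in> U}"
    then show "x \<in> (\<lambda>x. x + g) ` U" by (intro image_eqI[of _ _ "x - g"]) simp_all
  qed (auto simp: add.assoc simp del: add_uminus_conv_diff)
  then show ?thesis using open_translate_vimage_right[OF assms, of "- g"] by simp
qed

lemma nhd_zero_diff:
  fixes U :: "'a::topological_group_add set"
  assumes "open U" "0 \<in> U"
  obtains W where "open W" "0 \<in> W"
    "\<And>x y. x \<in> W \<Longrightarrow> y \<in> W \<Longrightarrow> x - y \<in> U"
    "\<And>x y. x \<in> W \<Longrightarrow> y \<in> W \<Longrightarrow> - x + y \<in> U"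
proof -
  have W: "\<exists>W. open W \<and> 0 \<in> W \<and> (\<forall>x\<in>W. \<forall>y\<in>W. f (x, y) \<in> U)"
    if cont: "continuous_on UNIV f" and "f (0, 0) = 0" for f :: "'a \<times> 'a \<Rightarrow> 'a"
  proof -
    have "open (f -` U)" by (rule open_vimage[OF assms(1) cont])
    moreover have "(0, 0) \<in> f -` U" using \<open>f (0, 0) = 0\<close> assms(2) by simp
    ultimately obtain A B where "open A" "open B" "(0,0) \<in> A \<times> B" "A \<times> B \<subseteq> f -` U"
      by (rule open_prod_elim)
    then show ?thesis by (intro exI[of _ "A \<inter> B"]) auto
  qed
  have "continuous_on UNIV (\<lambda>p::'a \<times> 'a. fst p + - snd p)"
    "continuous_on UNIV (\<lambda>p::'a \<times> 'a. - fst p + snd p)"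
    by (intro continuous_intros)+
  from this[THEN W] obtain W1 W2 where
    "open W1 \<and> 0 \<in> W1 \<and> (\<forall>x\<in>W1. \<forall>y\<in>W1. x - y \<in> U)"
    "open W2 \<and> 0 \<in> W2 \<and> (\<forall>x\<in>W2. \<forall>y\<in>W2. - x + y \<in> U)"
    by auto
  then show ?thesis by (intro that[of "W1 \<inter> W2"]) auto
qed

lemma countable_cover_left_translates:
  fixes W :: "'a::{topological_group_add, second_countable_topology} set"
  assumes "open W" "0 \<in> W"
  obtains c :: "nat \<Rightarrow> 'a" where "(\<Union>n. (+) (c n) ` W) = UNIV"
proof -
  obtain F where F: "F \<subseteq> range (\<lambda>c. (+) c ` W)" "countable F" "\<Union>F = \<Union>(range (\<lambda>c. (+) c ` W))"
    using Lindelof[of "range (\<lambda>c. (+) c ` W)"] open_translate_left[OF assms(1)] by auto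
  have "\<Union>(range (\<lambda>c. (+) c ` W)) = UNIV"
  proof -
    have "x \<in> (+) x ` W" for x using assms(2) by (intro image_eqI[of _ _ 0]) auto
    then show ?thesis by auto
  qed
  with F have U: "\<Union>F = UNIV" by simp
  then have "F \<noteq> {}" by auto
  obtain D where D: "D \<subseteq> UNIV" "countable D" "F = (\<lambda>c. (+) c ` W) ` D"
    using countable_subset_image[of F "\<lambda>c. (+) c ` W" UNIV] F by auto
  with \<open>F \<noteq> {}\<close> have "D \<noteq> {}" by auto
  then have r: "range (from_nat_into D) = D" using D by (simp add: range_from_nat_into)
  show ?thesis
  proof (rule that[of "from_nat_into D"])
    have "(\<Union>n. (+) (from_nat_into D n) ` W) = \<Union> ((\<lambda>c. (+) c ` W) ` range (from_nat_into D))"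
      by blast
    then show "(\<Union>n. (+) (from_nat_into D n) ` W) = UNIV"
      unfolding r D(3)[symmetric] U .
  qed
qed

lemma compact_cover_right_translates:
  fixes W :: "'a::topological_group_add set"
  assumes "compact K" "open W" "0 \<in> W"
  obtains F where "finite F" "K \<subseteq> (\<Union>c\<in>F. (\<lambda>x. x + c) ` W)"
proof -
  have "c \<in> (\<lambda>x. x + c) ` W" for c using assms(3) by (intro image_eqI[of _ _ 0]) auto
  then have "K \<subseteq> (\<Union>c\<in>K. (\<lambda>x. x + c) ` W)" by auto
  from compactE_image[OF assms(1) _ this] open_translate_right[OF assms(2)]
  obtain F where "F \<subseteq> K" "finite F" "K \<subseteq> (\<Union>c\<in>F. (\<lambda>x. x + c) ` W)" by metis
  then show ?thesis using that by blast
qed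

lemma compact_cover_left_translates:
  fixes W :: "'a::topological_group_add set"
  assumes "compact K" "open W" "0 \<in> W"
  obtains F where "finite F" "K \<subseteq> (\<Union>c\<in>F. (+) c ` W)"
proof -
  have "c \<in> (+) c ` W" for c using assms(3) by (intro image_eqI[of _ _ 0]) auto
  then have "K \<subseteq> (\<Union>c\<in>K. (+) c ` W)" by auto
  from compactE_image[OF assms(1) _ this] open_translate_left[OF assms(2)]
  obtain F where "F \<subseteq> K" "finite F" "K \<subseteq> (\<Union>c\<in>F. (+) c ` W)" by metis
  then show ?thesis using that by blast
qed

lemma compact_nhd_of_compact:
  fixes K :: "'a::t2_space set"
  assumes loc: "locally_compact_space (euclidean :: 'a topology)" and K: "compact K" and U: "open U" "K \<subseteq> U"
  obtains V C where "open V" "compact C" "K \<subseteq> V" "V \<subseteq> C" "C \<subseteq> U"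
proof -
  have "Hausdorff_space (euclidean :: 'a topology)"
    unfolding Hausdorff_space_def by (auto simp: disjnt_def separation_t2)
  then have nb: "neighbourhood_base_of (compactin euclidean) (euclidean :: 'a topology)"
    using loc locally_compact_space_neighbourhood_base by blast
  have "\<exists>V C. open V \<and> compact C \<and> x \<in> V \<and> V \<subseteq> C \<and> C \<subseteq> U" if "x \<in> K" for x
  proof -
    have "openin euclidean U \<and> x \<in> U" using U that by auto
    from nb[unfolded neighbourhood_base_of, rule_format, OF this]
    show ?thesis by simp
  qed
  then obtain V C where VC: "\<And>x. x \<in> K \<Longrightarrow> open (V x) \<and> compact (C x) \<and> x \<in> V x \<and> V x \<subseteq> C x \<and> C x \<subseteq> U"
    by metis
  have "K \<subseteq> (\<Union>x\<in>K. V x)" using VC by blast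
  from compactE_image[OF K _ this] obtain F where F: "F \<subseteq> K" "finite F" "K \<subseteq> (\<Union>x\<in>F. V x)"
    using VC by blast
  show ?thesis
  proof (rule that)
    show "open (\<Union>x\<in>F. V x)" using VC F(1) by blast
    show "compact (\<Union>x\<in>F. C x)" using VC F by (intro compact_UN) blast+
    show "K \<subseteq> (\<Union>x\<in>F. V x)" by fact
    show "(\<Union>x\<in>F. V x) \<subseteq> (\<Union>x\<in>F. C x)" "(\<Union>x\<in>F. C x) \<subseteq> U" using VC F(1) by blast+
  qed
qed

lemma compact_plus_small_nhd:
  fixes K V :: "'a::topological_group_add set"
  assumes K: "compact K" and V: "open V" "K \<subseteq> V"
  obtains U where "open U" "0 \<in> U" "\<And>u k. u \<in> U \<Longrightarrow> k \<in> K \<Longrightarrow> u + k \<in> V"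
    "\<And>u k. u \<in> U \<Longrightarrow> k \<in> K \<Longrightarrow> k + u \<in> V"
proof -
  have "\<exists>U V'. openin euclidean U \<and> openin euclidean V' \<and> 0 \<in> U \<and> K \<subseteq> V' \<and> U \<times> V' \<subseteq> f -` V"
    if "continuous_on UNIV f" "\<And>k. f (0, k) = k" for f :: "'a \<times> 'a \<Rightarrow> 'a"
  proof (rule tube_lemma_right)
    show "openin (prod_topology euclidean euclidean) (f -` V)"
      using open_vimage[OF V(1) that(1)] by simp
  qed (use K V that(2) in auto)
  from this[of "\<lambda>p. fst p + snd p"] this[of "\<lambda>p. snd p + fst p"]
  obtain U1 U2 V1 V2 where
    "open U1" "0 \<in> U1" "K \<subseteq> V1" "U1 \<times> V1 \<subseteq> (\<lambda>p. fst p + snd p) -` V"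
    "open U2" "0 \<in> U2" "K \<subseteq> V2" "U2 \<times> V2 \<subseteq> (\<lambda>p. snd p + fst p) -` V"
    by (auto simp: continuous_on_add continuous_on_fst continuous_on_snd)
  then show ?thesis by (intro that[of "U1 \<inter> U2"]) (auto simp: subset_iff)
qed

section \<open>Discrete subgroups\<close>

text \<open>
  The left translates of a fine enough neighbourhood of the identity are the pieces from which
  everything about a discrete subgroup is built: such a translate injects into \<open>G/H\<close>, since
  two of its points in the same left coset differ by some \<open>- w + w'\<close> in \<open>H\<close>, and meets \<open>H\<close>
  at most once.
\<close>
lemma discrete_subgroup_separated:
  fixes H :: "'a::topological_group_add set"
  assumes "discrete_subgroup H"
  obtains W where "open W" "0 \<in> W"
    "\<And>w w'. w \<in> W \<Longrightarrow> w' \<in> W \<Longrightarrow> - w + w' \<in> H \<Longrightarrow> w = w'"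
proof -
  have H: "is_subgroup H" "discrete H" using assms by (auto simp: discrete_subgroup_def)
  then have "0 isolated_in H" by (auto simp: is_subgroup_def discrete_def)
  then obtain T where T: "open T" "T \<inter> H = {0}" by (auto simp: isolated_in_def)
  then have "0 \<in> T" by auto
  from nhd_zero_diff[OF T(1) this] obtain W where W: "open W" "0 \<in> W"
    "\<And>x y. x \<in> W \<Longrightarrow> y \<in> W \<Longrightarrow> - x + y \<in> T" by metis
  have "w = w'" if "w \<in> W" "w' \<in> W" "- w + w' \<in> H" for w w'
  proof -
    have "- w + w' \<in> T \<inter> H" using W that by auto
    then have "- w + w' = 0" using T by auto
    then show ?thesis by (metis add.inverse_inverse minus_unique)
  qed
  with W that show ?thesis by blast
qed

lemma discrete_subgroup_meets_translate_at_most_once: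
  fixes H :: "'a::topological_group_add set"
  assumes "discrete_subgroup H"
  obtains W where "open W" "0 \<in> W" "\<And>c. \<exists>a. H \<inter> (+) c ` W \<subseteq> {a}"
proof -
  obtain W where W: "open W" "0 \<in> W"
    "\<And>w w'. w \<in> W \<Longrightarrow> w' \<in> W \<Longrightarrow> - w + w' \<in> H \<Longrightarrow> w = w'"
    using discrete_subgroup_separated[OF assms] by metis
  have H: "is_subgroup H" using assms by (auto simp: discrete_subgroup_def)
  have eq: "h = h'" if h: "h \<in> H" "h' \<in> H" "h \<in> (+) c ` W" "h' \<in> (+) c ` W" for c h h'
  proof -
    obtain w w' where w: "h = c + w" "h' = c + w'" "w \<in> W" "w' \<in> W" using h by blast
    have "- h + h' \<in> H" using H h by (auto simp: is_subgroup_def)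
    moreover have "- h + h' = - w + w'" unfolding w by (simp only: minus_add add.assoc minus_add_cancel)
    ultimately have "w = w'" using W(3)[of w w'] w(3,4) by metis
    then show ?thesis using w by simp
  qed
  have "\<exists>a. H \<inter> (+) c ` W \<subseteq> {a}" for c
    using eq[of _ _ c] by (cases "H \<inter> (+) c ` W = {}") (blast+)
  with W that show ?thesis by blast
qed

lemma discrete_subgroup_countable:
  fixes H :: "'a::{topological_group_add, second_countable_topology} set"
  assumes "discrete_subgroup H"
  shows "countable H"
proof -
  obtain W where W: "open W" "0 \<in> W"
    "\<And>c. \<exists>a. H \<inter> (+) c ` W \<subseteq> {a}"
    using discrete_subgroup_meets_translate_at_most_once[OF assms] by metis
  obtain c :: "nat \<Rightarrow> 'a" where c: "(\<Union>n. (+) (c n) ` W) = UNIV"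
    using countable_cover_left_translates[OF W(1,2)] .
  have "countable (H \<inter> (+) (c n) ` W)" for n
    using W(3)[of "c n"] by (metis countable_subset countable_insert countable_empty)
  then have "countable (\<Union>n. H \<inter> (+) (c n) ` W)" by blast
  moreover have "H = (\<Union>n. H \<inter> (+) (c n) ` W)" using c by (simp flip: Int_UN_distrib)
  ultimately show ?thesis by simp
qed

lemma discrete_subgroup_finite_Int_compact:
  fixes H :: "'a::topological_group_add set"
  assumes "discrete_subgroup H" "compact K"
  shows "finite (H \<inter> K)"
proof -
  obtain W where W: "open W" "0 \<in> W"
    "\<And>c. \<exists>a. H \<inter> (+) c ` W \<subseteq> {a}"
    using discrete_subgroup_meets_translate_at_most_once[OF assms(1)] by metis
  obtain F where F: "finite F" "K \<subseteq> (\<Union>c\<in>F. (+) c ` W)"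
    using compact_cover_left_translates[OF assms(2) W(1,2)] .
  have "finite (H \<inter> (+) c ` W)" for c
    using W(3)[of c] by (meson finite.emptyI finite.insertI finite_subset)
  then have "finite (\<Union>c\<in>F. H \<inter> (+) c ` W)" using F by blast
  then show ?thesis by (rule rev_finite_subset) (use F in auto)
qed

lemma discrete_subgroup_closed:
  fixes H :: "'a::{topological_group_add, t2_space} set"
  assumes "discrete_subgroup H"
  shows "closed H"
proof -
  obtain W where W: "open W" "0 \<in> W"
    "\<And>c. \<exists>a. H \<inter> (+) c ` W \<subseteq> {a}"
    using discrete_subgroup_meets_translate_at_most_once[OF assms] by metis
  have "\<exists>T. open T \<and> x \<in> T \<and> T \<subseteq> - H" if "x \<notin> H" for x
  proof -
    have fin: "finite (H \<inter> (+) x ` W)"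
      using W(3)[of x] by (meson finite.emptyI finite.insertI finite_subset)
    have "open ((+) x ` W - (H \<inter> (+) x ` W))"
      by (intro open_Diff open_translate_left W finite_imp_closed fin)
    moreover have "x \<in> (+) x ` W" using W(2) by (intro image_eqI[of _ _ 0]) auto
    ultimately show ?thesis using that by blast
  qed
  then have "open (- H)" by (subst open_subopen) auto
  then show ?thesis by (simp add: closed_def)
qed

section \<open>Uniform approximation and fundamental domains\<close>

text \<open>
  This is where compact generation enters. Once the compact generating set \<open>K\<close> is made
  symmetric by passing to \<open>K \<union> uminus ` K\<close>, it suffices that \<open>A = V + \<Gamma>\<^sub>j\<close> is stable under left
  translation by \<open>K\<close>, and as \<open>A\<close> absorbs \<open>\<Gamma>\<^sub>j\<close> from the right this follows from
  \<open>K + V \<subseteq> A\<close>. The latter concerns a relatively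
  compact set only: finitely many points of \<open>\<Gamma>\<^sub>j\<close>, one near each member of a finite net,
  already approximate all of \<open>K + V\<close> to precision \<open>V\<close>. So a density condition that is local
  on \<open>G\<close> becomes uniform.
\<close>
lemma eventually_small_nhd_plus_subgroup:
  fixes \<Gamma> :: "nat \<Rightarrow> 'a::topological_group_add set" and K C :: "'a set"
  assumes sub: "\<And>j. is_subgroup (\<Gamma> j)"
    and dense: "\<And>U. open U \<Longrightarrow> U \<noteq> {} \<Longrightarrow> \<exists>j0. \<forall>j\<ge>j0. U \<inter> \<Gamma> j \<noteq> {}"
    and K: "compact K" "is_subgroup hull K = UNIV"
    and V: "open V" "0 \<in> V" "V \<subseteq> C" "compact C"
  shows "\<forall>\<^sub>F j in sequentially. \<forall>s. \<exists>x\<in>V. \<exists>\<gamma>\<in>\<Gamma> j. s = x + \<gamma>"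
proof -
  define L where "L = (\<lambda>p. fst p + snd p) ` ((K \<union> uminus ` K) \<times> C)"
  have "compact (uminus ` K)"
    by (intro compact_continuous_image continuous_intros K)
  then have "compact L" unfolding L_def
    by (intro compact_continuous_image continuous_intros compact_Times compact_Un K V)
  obtain W where W: "open W" "0 \<in> W" "\<And>x y. x \<in> W \<Longrightarrow> y \<in> W \<Longrightarrow> x - y \<in> V"
    using nhd_zero_diff[OF V(1,2)] by metis
  obtain F where F: "finite F" "L \<subseteq> (\<Union>c\<in>F. (\<lambda>x. x + c) ` W)"
    using compact_cover_right_translates[OF \<open>compact L\<close> W(1,2)] .
  have "\<forall>\<^sub>F j in sequentially. (\<lambda>x. x + c) ` W \<inter> \<Gamma> j \<noteq> {}" for c
    using dense[of "(\<lambda>x. x + c) ` W"] open_translate_right[OF W(1)] W(2)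
    by (auto simp: eventually_sequentially)
  then have "\<forall>\<^sub>F j in sequentially. \<forall>c\<in>F. (\<lambda>x. x + c) ` W \<inter> \<Gamma> j \<noteq> {}"
    using F(1) by (simp add: eventually_ball_finite_distrib)
  then show ?thesis
  proof (rule eventually_mono)
    fix j assume j: "\<forall>c\<in>F. (\<lambda>x. x + c) ` W \<inter> \<Gamma> j \<noteq> {}"
    define A where "A = {x + \<gamma> |x \<gamma>. x \<in> V \<and> \<gamma> \<in> \<Gamma> j}"
    have LA: "L \<subseteq> A"
    proof
      fix l assume "l \<in> L"
      then obtain c w where c: "c \<in> F" "w \<in> W" "l = w + c" using F by auto
      then obtain w' where w': "w' \<in> W" "w' + c \<in> \<Gamma> j" using j by blast
      have "l = (w - w') + (w' + c)"
        unfolding c by (simp only: diff_conv_add_uminus add.assoc minus_add_cancel)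
      then show "l \<in> A" using W(3) c w' unfolding A_def by blast
    qed
    have step: "k + a \<in> A" if k: "k \<in> K \<union> uminus ` K" and "a \<in> A" for k a
    proof -
      obtain x \<gamma> where a: "a = x + \<gamma>" "x \<in> V" "\<gamma> \<in> \<Gamma> j" using \<open>a \<in> A\<close> unfolding A_def by blast
      have "k + x \<in> L" unfolding L_def using k a V by (intro image_eqI[of _ _ "(k, x)"]) auto
      then have "k + x \<in> A" using LA by blast
      then obtain y \<delta> where "k + x = y + \<delta>" "y \<in> V" "\<delta> \<in> \<Gamma> j" unfolding A_def by auto
      then have "k + a = y + (\<delta> + \<gamma>)" "\<delta> + \<gamma> \<in> \<Gamma> j"
        using a sub[of j] by (auto simp: is_subgroup_def add.assoc[symmetric])
      then show ?thesis using \<open>y \<in> V\<close> unfolding A_def by blast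
    qed
    \<comment> \<open>The stabiliser of \<open>A\<close>. Translations into \<open>A\<close> alone would only give a semigroup, hence
      the condition on both \<open>g\<close> and \<open>- g\<close>.\<close>
    define S where "S = {g. \<forall>a\<in>A. g + a \<in> A \<and> - g + a \<in> A}"
    have "is_subgroup S"
      unfolding is_subgroup_def S_def
      by (auto simp: add.assoc minus_add simp del: add_uminus_conv_diff)
    moreover have "K \<subseteq> S" unfolding S_def using step by auto
    ultimately have "is_subgroup hull K \<subseteq> S" by (intro hull_minimal)
    then have "S = UNIV" using K by auto
    moreover have "0 \<in> A" unfolding A_def using V(2) sub[of j] by (force simp: is_subgroup_def)
    ultimately have "s \<in> A" for s unfolding S_def by (metis (mono_tags, lifting) UNIV_I add.right_neutral mem_Collect_eq)
    then show "\<forall>s. \<exists>x\<in>V. \<exists>\<gamma>\<in>\<Gamma> j. s = x + \<gamma>" unfolding A_def by blast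
  qed
qed

text \<open>
  Cut \<open>V\<close> into countably many open pieces \<open>P n\<close>, each injecting into \<open>G/H\<close>, and keep of
  each piece only the points whose coset is not represented by an earlier piece. The saturations
  \<open>Q n\<close> of the pieces are open, so the result is Borel.
\<close>
lemma ex_fundamental_domain:
  fixes H :: "'a::{topological_group_add, second_countable_topology} set"
  assumes H: "discrete_subgroup H" and V: "open V" "\<And>s. \<exists>x\<in>V. \<exists>h\<in>H. s = x + h"
  obtains X where "fundamental_domain H X" "X \<subseteq> V"
proof -
  have sub: "is_subgroup H" using H by (simp add: discrete_subgroup_def)
  obtain W where W: "open W" "0 \<in> W"
    "\<And>w w'. w \<in> W \<Longrightarrow> w' \<in> W \<Longrightarrow> - w + w' \<in> H \<Longrightarrow> w = w'"
    using discrete_subgroup_separated[OF H] by metis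
  obtain c :: "nat \<Rightarrow> 'a" where c: "(\<Union>n. (+) (c n) ` W) = UNIV"
    using countable_cover_left_translates[OF W(1,2)] .
  define P where "P n = V \<inter> (+) (c n) ` W" for n
  define Q where "Q n = (\<Union>h\<in>H. (\<lambda>x. x + h) ` P n)" for n
  define X where "X = (\<Union>n. P n - (\<Union>m<n. Q m))"
  have oP: "open (P n)" for n unfolding P_def by (intro open_Int V open_translate_left W)
  have oQ: "open (Q n)" for n unfolding Q_def by (intro open_UN ballI open_translate_right oP)
  have inj: "p = q" if "p \<in> P n" "q \<in> P n" and pq: "- p + q \<in> H" for p q n
  proof -
    obtain w w' where w: "p = c n + w" "q = c n + w'" "w \<in> W" "w' \<in> W"
      using \<open>p \<in> P n\<close> \<open>q \<in> P n\<close> unfolding P_def by blast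
    have "- p + q = - w + w'" unfolding w by (simp only: minus_add add.assoc minus_add_cancel)
    then have "w = w'" using W(3)[of w w'] w(3,4) pq by metis
    then show ?thesis using w by simp
  qed
  have QH: "q + h \<in> Q n" if "q \<in> Q n" "h \<in> H" for q h n
  proof -
    obtain p h' where "p \<in> P n" "h' \<in> H" "q = p + h'" using \<open>q \<in> Q n\<close> by (auto simp: Q_def)
    moreover then have "h' + h \<in> H" using sub that by (auto simp: is_subgroup_def)
    ultimately show ?thesis unfolding Q_def by (auto simp: add.assoc intro!: bexI[of _ "h' + h"])
  qed
  have PQ: "P n \<subseteq> Q n" for n
  proof
    fix p assume "p \<in> P n"
    moreover have "0 \<in> H" using sub by (simp add: is_subgroup_def)
    ultimately show "p \<in> Q n" unfolding Q_def by force
  qed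
  have "P n - (\<Union>m<n. Q m) \<in> sets borel" for n
    by (intro sets.Diff borel_open oP oQ open_UN ballI)
  then have "X \<in> sets borel" unfolding X_def by blast
  moreover have "(\<Union>h\<in>H. (\<lambda>x. x + h) ` X) = UNIV"
  proof -
    have "s \<in> (\<Union>h\<in>H. (\<lambda>x. x + h) ` X)" for s
    proof -
      obtain x h where x: "x \<in> V" "h \<in> H" "s = x + h" using V(2) by blast
      obtain n0 where "x \<in> (+) (c n0) ` W" using c by blast
      then have "x \<in> Q n0" using x PQ by (auto simp: P_def)
      define n where "n = (LEAST n. x \<in> Q n)"
      have n: "x \<in> Q n" unfolding n_def using \<open>x \<in> Q n0\<close> by (rule LeastI)
      have least: "x \<notin> Q m" if "m < n" for m using not_less_Least[of m "\<lambda>n. x \<in> Q n"] that n_def by auto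
      obtain p k where p: "p \<in> P n" "k \<in> H" "x = p + k" using n by (auto simp: Q_def)
      have "p \<notin> Q m" if "m < n" for m using QH[of p m k] least[OF that] p by auto
      then have "p \<in> X" unfolding X_def using p by blast
      moreover have "k + h \<in> H" "s = p + (k + h)" using p x sub by (auto simp: is_subgroup_def add.assoc)
      ultimately show ?thesis by blast
    qed
    then show ?thesis by blast
  qed
  moreover have "disjoint_family_on (\<lambda>h. (\<lambda>x. x + h) ` X) H"
    unfolding disjoint_family_on_def
  proof (intro ballI impI, rule ccontr)
    fix h k assume hk: "h \<in> H" "k \<in> H" "h \<noteq> k" "(\<lambda>x. x + h) ` X \<inter> (\<lambda>x. x + k) ` X \<noteq> {}"
    then obtain x y where xy: "x \<in> X" "y \<in> X" "x + h = y + k" by force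
    then obtain n m where nm: "x \<in> P n - (\<Union>m<n. Q m)" "y \<in> P m - (\<Union>i<m. Q i)" unfolding X_def by blast
    have nk: "- k \<in> H" "- h \<in> H" using hk sub by (auto simp: is_subgroup_def)
    then have hk': "h + - k \<in> H" "k + - h \<in> H" using hk sub unfolding is_subgroup_def by blast+
    have y: "y = x + (h + - k)"
      using xy(3) by (metis add.assoc add.right_inverse add.right_neutral)
    have x: "x = y + (k + - h)"
      using xy(3) by (metis add.assoc add.right_inverse add.right_neutral)
    have "x \<in> Q m" using QH[OF _ hk'(2), of y m] PQ nm(2) x by auto
    moreover have "y \<in> Q n" using QH[OF _ hk'(1), of x n] PQ nm(1) y by auto
    ultimately have "n = m" using nm by (metis DiffD2 UN_I lessThan_iff linorder_cases)
    have "- x + y = h + - k" unfolding y by (simp only: minus_add_cancel)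
    then have "x = y" using inj[of x n y] nm \<open>n = m\<close> hk' by auto
    then show False using xy(3) hk(3) by auto
  qed
  ultimately have "fundamental_domain H X" by (simp add: fundamental_domain_def)
  moreover have "X \<subseteq> V" by (auto simp: X_def P_def)
  ultimately show ?thesis using that by blast
qed

section \<open>Borel measures from contents on compact sets\<close>

text \<open>
  The passage from a content on compact sets to a Borel measure. The content \<open>lam\<close> is additive
  on disjoint compact sets but need not be regular: a limit of counting measures may jump on
  boundaries. Regularisation from inside on open sets and then from outside on arbitrary sets
  repairs this, at the price that the measure of a compact set is only bounded below by its
  content.
\<close>
locale compact_content =
  fixes lam :: "'a::t2_space set \<Rightarrow> ennreal"
  assumes loc: "locally_compact_space (euclidean :: 'a topology)"
    and lam_empty: "lam {} = 0"
    and lam_mono: "compact K \<Longrightarrow> compact L \<Longrightarrow> K \<subseteq> L \<Longrightarrow> lam K \<le> lam L"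
    and lam_subadd: "compact K \<Longrightarrow> compact L \<Longrightarrow> lam (K \<union> L) \<le> lam K + lam L"
    and lam_add: "compact K \<Longrightarrow> compact L \<Longrightarrow> K \<inter> L = {} \<Longrightarrow> lam K + lam L \<le> lam (K \<union> L)"
begin

definition inner_content :: "'a set \<Rightarrow> ennreal" where
  "inner_content U = (SUP K\<in>{K. compact K \<and> K \<subseteq> U}. lam K)"

definition outer_content :: "'a set \<Rightarrow> ennreal" where
  "outer_content E = (INF U\<in>{U. open U \<and> E \<subseteq> U}. inner_content U)"

definition content_measure :: "'a measure" where
  "content_measure = measure_of UNIV (sets borel) outer_content"

lemma lam_le_inner_content: "compact K \<Longrightarrow> K \<subseteq> U \<Longrightarrow> lam K \<le> inner_content U"
  unfolding inner_content_def by (rule SUP_upper) simp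

lemma inner_content_least: "(\<And>K. compact K \<Longrightarrow> K \<subseteq> U \<Longrightarrow> lam K \<le> b) \<Longrightarrow> inner_content U \<le> b"
  unfolding inner_content_def by (rule SUP_least) simp

lemma outer_content_le_inner_content: "open U \<Longrightarrow> E \<subseteq> U \<Longrightarrow> outer_content E \<le> inner_content U"
  unfolding outer_content_def by (rule INF_lower) simp

lemma outer_content_greatest: "(\<And>U. open U \<Longrightarrow> E \<subseteq> U \<Longrightarrow> b \<le> inner_content U) \<Longrightarrow> b \<le> outer_content E"
  unfolding outer_content_def by (rule INF_greatest) simp

lemma outer_content_mono: "E \<subseteq> F \<Longrightarrow> outer_content E \<le> outer_content F"
  by (rule outer_content_greatest) (auto intro: outer_content_le_inner_content)

lemma lam_le_outer_content: "compact K \<Longrightarrow> lam K \<le> outer_content K"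
  by (rule outer_content_greatest) (rule lam_le_inner_content)

lemma inner_content_Un:
  assumes "open U" "open V"
  shows "inner_content (U \<union> V) \<le> inner_content U + inner_content V"
proof (rule inner_content_least)
  fix K assume K: "compact K" "K \<subseteq> U \<union> V"
  have "compact (K - V)" using compact_diff[OF K(1) assms(2)] .
  moreover have "K - V \<subseteq> U" using K by auto
  ultimately obtain W C where W: "open W" "compact C" "K - V \<subseteq> W" "W \<subseteq> C" "C \<subseteq> U"
    by (rule compact_nhd_of_compact[OF loc _ assms(1)])
  have c1: "compact (K \<inter> C)" by (intro compact_Int K W)
  have c2: "compact (K - W)" by (intro compact_diff K W)
  \<comment> \<open>A splitting of \<open>K\<close> into compact pieces inside \<open>U\<close> and inside \<open>V\<close>.\<close>
  have "K = (K \<inter> C) \<union> (K - W)" using W by auto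
  then have "lam K \<le> lam (K \<inter> C) + lam (K - W)" using lam_subadd[OF c1 c2] by simp
  also have "\<dots> \<le> inner_content U + inner_content V"
    using W by (intro add_mono lam_le_inner_content c1 c2) auto
  finally show "lam K \<le> inner_content U + inner_content V" .
qed

lemma inner_content_UN_lessThan:
  assumes "\<And>i. open (U i)"
  shows "inner_content (\<Union>i<(n::nat). U i) \<le> (\<Sum>i<n. inner_content (U i))"
proof (induction n)
  case 0
  have "inner_content {} \<le> 0" by (rule inner_content_least) (simp add: lam_empty)
  then show ?case by simp
next
  case (Suc n)
  have "inner_content (\<Union>i<Suc n. U i) = inner_content ((\<Union>i<n. U i) \<union> U n)"
    by (simp add: lessThan_Suc Un_commute)
  also have "\<dots> \<le> inner_content (\<Union>i<n. U i) + inner_content (U n)" using assms by (intro inner_content_Un) auto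
  also have "\<dots> \<le> (\<Sum>i<n. inner_content (U i)) + inner_content (U n)" by (intro add_right_mono Suc)
  finally show ?case by simp
qed

lemma inner_content_UN:
  assumes "\<And>i::nat. open (U i)"
  shows "inner_content (\<Union>i. U i) \<le> (\<Sum>i. inner_content (U i))"
proof (rule inner_content_least)
  fix K assume K: "compact K" "K \<subseteq> (\<Union>i. U i)"
  obtain F where F: "finite F" "K \<subseteq> (\<Union>i\<in>F. U i)"
    using compactE_image[OF K(1) _ K(2)] assms by metis
  obtain n where "F \<subseteq> {..<n}" using finite_nat_iff_bounded F(1) by blast
  then have "K \<subseteq> (\<Union>i<n. U i)" using F by blast
  then have "lam K \<le> inner_content (\<Union>i<n. U i)" using K by (intro lam_le_inner_content)
  also have "\<dots> \<le> (\<Sum>i<n. inner_content (U i))" by (rule inner_content_UN_lessThan[OF assms])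
  also have "\<dots> \<le> (\<Sum>i. inner_content (U i))" by (rule sum_le_suminf) auto
  finally show "lam K \<le> (\<Sum>i. inner_content (U i))" .
qed

lemma outer_content_empty: "outer_content {} = 0"
proof -
  have "inner_content {} \<le> 0" by (rule inner_content_least) (simp add: lam_empty)
  then have "outer_content {} \<le> 0" using outer_content_le_inner_content[of "{}" "{}"] by auto
  then show ?thesis by simp
qed

lemma outer_content_UN: "outer_content (\<Union>i::nat. A i) \<le> (\<Sum>i. outer_content (A i))"
proof (rule ennreal_le_epsilon)
  fix e :: real assume fin: "(\<Sum>i. outer_content (A i)) < top" and e: "0 < e"
  have "\<exists>U. open U \<and> A i \<subseteq> U \<and> inner_content U \<le> outer_content (A i) + ennreal (e * (1/2) ^ Suc i)" for i
  proof -
    have "outer_content (A i) \<le> (\<Sum>i. outer_content (A i))"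
      using sum_le_suminf[of "\<lambda>i. outer_content (A i)" "{i}"] by auto
    then have "outer_content (A i) < top" using fin by (rule order.strict_trans1)
    moreover have "0 < ennreal (e * (1/2) ^ Suc i)" using e by simp
    ultimately have "outer_content (A i) < outer_content (A i) + ennreal (e * (1/2) ^ Suc i)"
      by (simp add: ennreal_add_left_cancel_less[of _ 0, simplified] less_top)
    then obtain U where "open U" "A i \<subseteq> U" "inner_content U < outer_content (A i) + ennreal (e * (1/2) ^ Suc i)"
      unfolding outer_content_def[of "A i"] INF_less_iff by auto
    then show ?thesis by (auto intro: less_imp_le)
  qed
  then obtain U where U: "\<And>i. open (U i)" "\<And>i. A i \<subseteq> U i"
    "\<And>i. inner_content (U i) \<le> outer_content (A i) + ennreal (e * (1/2) ^ Suc i)" by metis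
  have "outer_content (\<Union>i. A i) \<le> inner_content (\<Union>i. U i)" using U by (intro outer_content_le_inner_content) auto
  also have "\<dots> \<le> (\<Sum>i. inner_content (U i))" by (rule inner_content_UN[OF U(1)])
  also have "\<dots> \<le> (\<Sum>i. outer_content (A i) + ennreal (e * (1/2) ^ Suc i))"
    by (intro suminf_le U) auto
  also have "\<dots> = (\<Sum>i. outer_content (A i)) + (\<Sum>i. ennreal (e * (1/2) ^ Suc i))"
    by (intro suminf_add[symmetric]) auto
  also have "(\<Sum>i. ennreal (e * (1/2) ^ Suc i)) = ennreal e"
    using e power_half_series[THEN sums_mult, of e] by (intro suminf_ennreal_eq) auto
  finally show "outer_content (\<Union>i. A i) \<le> (\<Sum>i. outer_content (A i)) + ennreal e" .
qed

lemma outer_content_Un: "outer_content (A \<union> B) \<le> outer_content A + outer_content B"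
proof -
  have "outer_content (\<Union>i. binaryset A B i) \<le> (\<Sum>i. outer_content (binaryset A B i))" by (rule outer_content_UN)
  then show ?thesis by (simp add: UN_binaryset_eq suminf_binaryset_eq[of outer_content] outer_content_empty)
qed

lemma outer_measure_space_outer_content: "outer_measure_space UNIV outer_content"
  unfolding outer_measure_space_def positive_def increasing_def countably_subadditive_def
  using outer_content_empty outer_content_mono outer_content_UN by auto

text \<open>
  The Caratheodory condition has to be checked only against open test sets \<open>A\<close>. There one
  exhausts \<open>A \<inter> U\<close> by compact \<open>K\<close>, and then the open set \<open>A - K\<close>, which contains \<open>A - U\<close>, by
  compact \<open>L\<close>; additivity on the disjoint sets \<open>K\<close> and \<open>L\<close> gives the inequality.
\<close>
lemma open_in_lambda_system:
  assumes U: "open U"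
  shows "U \<in> lambda_system UNIV UNIV outer_content"
proof -
  have "outer_content (U \<inter> E) + outer_content ((UNIV - U) \<inter> E) \<le> inner_content A" if A: "open A" "E \<subseteq> A" for A E
  proof -
    have K: "lam K + outer_content (A - U) \<le> inner_content A" if K: "compact K" "K \<subseteq> A \<inter> U" for K
    proof -
      have o: "open (A - K)" using A compact_imp_closed[OF K(1)] by auto
      have "lam K + lam L \<le> inner_content A" if L: "compact L" "L \<subseteq> A - K" for L
      proof -
        have "lam K + lam L \<le> lam (K \<union> L)" using K L by (intro lam_add) auto
        also have "\<dots> \<le> inner_content A" using K L by (intro lam_le_inner_content compact_Un) auto
        finally show ?thesis .
      qed
      then have "(SUP L\<in>{L. compact L \<and> L \<subseteq> A - K}. lam K + lam L) \<le> inner_content A"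
        by (intro SUP_least) auto
      moreover have "{L. compact L \<and> L \<subseteq> A - K} \<noteq> {}" using compact_empty by blast
      ultimately have "lam K + inner_content (A - K) \<le> inner_content A"
        unfolding inner_content_def[of "A - K"] by (subst ennreal_SUP_add_right)
      moreover have "outer_content (A - U) \<le> inner_content (A - K)" using K o by (intro outer_content_le_inner_content) auto
      ultimately show ?thesis by (meson add_left_mono order_trans)
    qed
    have "(SUP K\<in>{K. compact K \<and> K \<subseteq> A \<inter> U}. lam K + outer_content (A - U)) \<le> inner_content A"
      using K by (intro SUP_least) auto
    moreover have "{K. compact K \<and> K \<subseteq> A \<inter> U} \<noteq> {}" using compact_empty by blast
    ultimately have "inner_content (A \<inter> U) + outer_content (A - U) \<le> inner_content A"
      unfolding inner_content_def[of "A \<inter> U"] by (subst (asm) ennreal_SUP_add_left) auto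
    moreover have "outer_content (U \<inter> E) \<le> inner_content (A \<inter> U)" using A U by (intro outer_content_le_inner_content) auto
    moreover have "outer_content ((UNIV - U) \<inter> E) \<le> outer_content (A - U)" using A by (intro outer_content_mono) auto
    ultimately show ?thesis by (meson add_mono order_trans)
  qed
  then have "outer_content (U \<inter> E) + outer_content ((UNIV - U) \<inter> E) \<le> outer_content E" for E
    by (rule outer_content_greatest)
  moreover have "outer_content E \<le> outer_content (U \<inter> E) + outer_content ((UNIV - U) \<inter> E)" for E
    using outer_content_Un[of "U \<inter> E" "(UNIV - U) \<inter> E"] by (metis Int_Un_distrib2 Int_UNIV_left Un_Diff_cancel Un_UNIV_right)
  ultimately show ?thesis unfolding lambda_system_def by (auto intro: antisym)
qed

lemma sets_content_measure [simp]: "sets content_measure = sets borel"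
  unfolding content_measure_def using sets.sigma_sets_eq[of borel] by (simp add: sets_measure_of)

lemma emeasure_content_measure: "A \<in> sets borel \<Longrightarrow> emeasure content_measure A = outer_content A"
proof -
  assume A: "A \<in> sets borel"
  interpret s: sigma_algebra UNIV "UNIV :: 'a set set" using sigma_algebra_Pow[of UNIV] by simp
  have ms: "measure_space UNIV (lambda_system UNIV UNIV outer_content) outer_content"
    by (rule s.caratheodory_lemma[OF outer_measure_space_outer_content])
  then have sa: "sigma_algebra UNIV (lambda_system UNIV UNIV outer_content)" by (simp add: measure_space_def)
  have "sets borel = sigma_sets UNIV {S :: 'a set. open S}"
    by (simp add: borel_def sets_measure_of)
  also have "\<dots> \<subseteq> lambda_system UNIV UNIV outer_content"
    using open_in_lambda_system by (intro sigma_algebra.sigma_sets_subset[OF sa]) auto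
  finally have "sets borel \<subseteq> lambda_system UNIV UNIV outer_content" .
  moreover have sb: "sigma_algebra UNIV (sets (borel :: 'a measure))"
    using sets.sigma_algebra_axioms[of borel] by simp
  ultimately have "measure_space UNIV (sets borel) outer_content"
    using measure_down[OF ms] by blast
  then show ?thesis
    unfolding content_measure_def measure_space_def
    using A by (intro emeasure_measure_of_sigma) auto
qed

lemma emeasure_content_measure_finite:
  assumes fin: "\<And>K. compact K \<Longrightarrow> lam K < top" and "compact K"
  shows "emeasure content_measure K < top"
proof -
  obtain V C where V: "open V" "compact C" "K \<subseteq> V" "V \<subseteq> C"
    using compact_nhd_of_compact[OF loc \<open>compact K\<close>, of UNIV] by auto
  have "emeasure content_measure K = outer_content K"
    by (intro emeasure_content_measure borel_compact assms)
  also have "\<dots> \<le> inner_content V" using V by (intro outer_content_le_inner_content)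
  also have "\<dots> \<le> lam C" using V by (intro inner_content_least lam_mono) auto
  also have "\<dots> < top" by (rule fin[OF V(2)])
  finally show ?thesis .
qed

lemma emeasure_content_measure_ge:
  assumes "compact K" shows "lam K \<le> emeasure content_measure K"
  using lam_le_outer_content[OF assms] emeasure_content_measure[OF borel_compact[OF assms]] by simp

text \<open>
  An approximate invariance of the content suffices for the exact invariance of the measure:
  the content of \<open>T ` K\<close> need be compared only with that of compact neighbourhoods of \<open>K\<close>,
  because the inner regularisation on an open set leaves room around every compact subset.
\<close>
lemma inner_content_le_of_almost_contraction:
  assumes T: "continuous_on UNIV T" "continuous_on UNIV S" "\<And>x. T (S x) = x" "\<And>x. S (T x) = x"
    and le: "\<And>K C V. compact K \<Longrightarrow> compact C \<Longrightarrow> open V \<Longrightarrow> K \<subseteq> V \<Longrightarrow> V \<subseteq> C \<Longrightarrow> lam (T ` K) \<le> lam C"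
    and U: "open U"
  shows "inner_content (T ` U) \<le> inner_content U"
proof (rule inner_content_least)
  fix K assume K: "compact K" "K \<subseteq> T ` U"
  have "compact (S ` K)"
    by (rule compact_continuous_image[OF continuous_on_subset[OF T(2)] K(1)]) simp
  moreover have "S ` K \<subseteq> U" using K T by force
  ultimately obtain V C where V: "open V" "compact C" "S ` K \<subseteq> V" "V \<subseteq> C" "C \<subseteq> U"
    by (rule compact_nhd_of_compact[OF loc _ U])
  have "T ` S ` K = K" using T by (simp add: image_image)
  then have "lam K \<le> lam C" using le[OF \<open>compact (S ` K)\<close> V(2,1,3,4)] by simp
  also have "\<dots> \<le> inner_content U" using V by (intro lam_le_inner_content)
  finally show "lam K \<le> inner_content U" .
qed

lemma outer_content_le_of_almost_contraction:
  assumes T: "continuous_on UNIV T" "continuous_on UNIV S" "\<And>x. T (S x) = x" "\<And>x. S (T x) = x"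
    and le: "\<And>K C V. compact K \<Longrightarrow> compact C \<Longrightarrow> open V \<Longrightarrow> K \<subseteq> V \<Longrightarrow> V \<subseteq> C \<Longrightarrow> lam (T ` K) \<le> lam C"
  shows "outer_content (T ` E) \<le> outer_content E"
proof (rule outer_content_greatest)
  fix U assume U: "open U" "E \<subseteq> U"
  have "T ` U = S -` U" using T by (auto simp: image_iff) metis
  then have "open (T ` U)" using open_vimage[OF U(1) T(2)] by simp
  then have "outer_content (T ` E) \<le> inner_content (T ` U)" using U by (intro outer_content_le_inner_content) auto
  also have "\<dots> \<le> inner_content U" by (rule inner_content_le_of_almost_contraction[OF T le U(1)])
  finally show "outer_content (T ` E) \<le> inner_content U" .
qed

lemma emeasure_content_measure_invariant:
  assumes T: "continuous_on UNIV T" "continuous_on UNIV S" "\<And>x. T (S x) = x" "\<And>x. S (T x) = x"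
    and leT: "\<And>K C V. compact K \<Longrightarrow> compact C \<Longrightarrow> open V \<Longrightarrow> K \<subseteq> V \<Longrightarrow> V \<subseteq> C \<Longrightarrow> lam (T ` K) \<le> lam C"
    and leS: "\<And>K C V. compact K \<Longrightarrow> compact C \<Longrightarrow> open V \<Longrightarrow> K \<subseteq> V \<Longrightarrow> V \<subseteq> C \<Longrightarrow> lam (S ` K) \<le> lam C"
    and A: "A \<in> sets borel"
  shows "emeasure content_measure (T ` A) = emeasure content_measure A"
proof -
  have "T ` A = S -` A \<inter> space borel" using T by (auto simp: image_iff) metis
  moreover have "S \<in> borel_measurable borel" using T(2) by (rule borel_measurable_continuous_onI)
  ultimately have TA: "T ` A \<in> sets borel" using A by (metis measurable_sets)
  have "outer_content (T ` A) \<le> outer_content A" by (rule outer_content_le_of_almost_contraction[OF T leT])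
  moreover have "outer_content (S ` T ` A) \<le> outer_content (T ` A)"
    by (rule outer_content_le_of_almost_contraction[OF T(2,1,4,3) leS])
  ultimately show ?thesis using T A TA by (simp add: emeasure_content_measure image_image)
qed

end

section \<open>An invariant measure as a limit of counting measures\<close>

text \<open>
  By Tychonoff's theorem \<^typ>\<open>'b \<Rightarrow> ennreal\<close> is compact, so every sequence in it has a cluster
  point. In terms of a filter finer than \<^term>\<open>sequentially\<close> the cluster point is an honest
  limit, simultaneously at all arguments, and so inherits (in)equalities and sums.
\<close>
lemma pointwise_cluster_filter:
  fixes f :: "nat \<Rightarrow> 'b \<Rightarrow> ennreal"
  obtains F g where "F \<noteq> bot" "F \<le> sequentially" "\<forall>E. ((\<lambda>j. f j E) \<longlongrightarrow> g E) F"
proof -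
  have "compactin (product_topology (\<lambda>i::'b. euclidean :: ennreal topology) UNIV) (PiE UNIV (\<lambda>_. UNIV))"
    unfolding compactin_PiE by (simp add: compact_UNIV)
  then have "compact (UNIV :: ('b \<Rightarrow> ennreal) set)"
    by (simp add: euclidean_product_topology)
  then obtain g where g: "inf (nhds g) (filtermap f sequentially) \<noteq> bot"
    unfolding compact_filter by (metis UNIV_I always_eventually filtermap_bot_iff trivial_limit_sequentially)
  define F where "F = inf sequentially (filtercomap f (nhds g))"
  have "F \<noteq> bot"
  proof
    assume "F = bot"
    then have "eventually (\<lambda>_. False) F" by simp
    then obtain P Q where P: "eventually P sequentially" and Q: "eventually Q (filtercomap f (nhds g))"
      and PQ: "\<And>x. P x \<Longrightarrow> Q x \<Longrightarrow> False"
      unfolding F_def eventually_inf by blast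
    from Q obtain R where R: "eventually R (nhds g)" "\<And>x. R (f x) \<Longrightarrow> Q x"
      unfolding eventually_filtercomap by blast
    have "eventually (\<lambda>y. \<not> R y) (filtermap f sequentially)"
      unfolding eventually_filtermap using P by (rule eventually_mono) (use PQ R in blast)
    with R(1) have "eventually (\<lambda>_. False) (inf (nhds g) (filtermap f sequentially))"
      unfolding eventually_inf by blast
    with g show False by (simp add: trivial_limit_def)
  qed
  moreover have "F \<le> sequentially" by (simp add: F_def)
  moreover have "((\<lambda>j. f j E) \<longlongrightarrow> g E) F" for E
  proof -
    have "F \<le> filtercomap f (nhds g)" by (simp add: F_def)
    then have lim: "(f \<longlongrightarrow> g) F"
      by (metis filterlim_filtercomap filterlim_mono order_refl)
    have "continuous_on UNIV (\<lambda>h::'b \<Rightarrow> ennreal. h E)" by (rule continuous_on_product_coordinates)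
    then have "open ((\<lambda>h::'b \<Rightarrow> ennreal. h E) -` S)" if "open S" for S
      using that by (intro open_vimage)
    then show ?thesis
      by (intro topological_tendstoI) (use topological_tendstoD[OF lim] in fastforce)
  qed
  ultimately show ?thesis using that by blast
qed

lemma emeasure_count_space_inj_le:
  assumes "inj_on g A" "g ` A \<subseteq> B"
  shows "emeasure (count_space UNIV) A \<le> emeasure (count_space UNIV) B"
proof (cases "finite B")
  case True
  then have "finite A" using assms inj_on_finite by blast
  then show ?thesis using True card_inj_on_le[OF assms True] by simp
next
  case False
  then show ?thesis by simp
qed

text \<open>
  A Haar measure obtained as a limit of counting measures on the \<open>\<Gamma> j\<close>. Counting on \<open>\<Gamma> j\<close> is
  invariant under left and right translation by elements of \<open>\<Gamma> j\<close>, and these elements come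
  arbitrarily close to every \<open>g\<close>; hence the limit is invariant on both sides. In particular a
  group approximated by discrete subgroups is unimodular.
\<close>
lemma ex_biinvariant_measure:
  fixes \<Gamma> :: "nat \<Rightarrow> 'a::{topological_group_add, t2_space} set"
  assumes loc: "locally_compact_space (euclidean :: 'a topology)"
    and disc: "\<And>j. discrete_subgroup (\<Gamma> j)"
    and dense: "\<And>U. open U \<Longrightarrow> U \<noteq> {} \<Longrightarrow> \<exists>j0. \<forall>j\<ge>j0. U \<inter> \<Gamma> j \<noteq> {}"
  obtains \<mu> :: "'a measure" where "sets \<mu> = sets borel" "emeasure \<mu> UNIV \<noteq> 0"
    "\<And>K. compact K \<Longrightarrow> emeasure \<mu> K < top"
    "\<And>g A. A \<in> sets borel \<Longrightarrow> emeasure \<mu> ((+) g ` A) = emeasure \<mu> A"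
    "\<And>g A. A \<in> sets borel \<Longrightarrow> emeasure \<mu> ((\<lambda>x. x + g) ` A) = emeasure \<mu> A"
proof -
  have sub: "is_subgroup (\<Gamma> j)" for j using disc by (simp add: discrete_subgroup_def)
  have ev_dense: "\<forall>\<^sub>F j in sequentially. U \<inter> \<Gamma> j \<noteq> {}" if "open U" "x \<in> U" for U x
    unfolding eventually_sequentially using dense[of U] that by blast
  obtain V0 C0 :: "'a set" where V0: "open V0" "compact C0" "{0} \<subseteq> V0" "V0 \<subseteq> C0" "C0 \<subseteq> UNIV"
    using compact_nhd_of_compact[OF loc compact_sing[of 0] open_UNIV subset_UNIV] .
  obtain W where W: "open W" "0 \<in> W" "\<And>x y. x \<in> W \<Longrightarrow> y \<in> W \<Longrightarrow> x - y \<in> V0"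
    using nhd_zero_diff[of V0] V0(1,3) by (metis insert_subset)
  \<comment> \<open>The counts are normalised by those on a fixed compact set \<open>C0\<close>. It contains the
    differences of the elements of \<open>W\<close>, so a translate of \<open>W\<close> never counts more points.\<close>
  define N where "N j E = emeasure (count_space UNIV) (\<Gamma> j \<inter> E)" for j E
  define f where "f j E = N j E / N j C0" for j E
  have N_mono: "N j A \<le> N j B" if "A \<subseteq> B" for j A B
    unfolding N_def using that by (intro emeasure_mono) auto
  have N_Un: "N j (A \<union> B) \<le> N j A + N j B" for j A B
    unfolding N_def using emeasure_subadditive[of "\<Gamma> j \<inter> A" "count_space UNIV" "\<Gamma> j \<inter> B"]
    by (simp add: Int_Un_distrib)
  have N_disj: "N j (A \<union> B) = N j A + N j B" if "A \<inter> B = {}" for j A B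
    unfolding N_def Int_Un_distrib using that by (subst plus_emeasure) auto
  have N_C0: "0 < N j C0" "N j C0 < top" for j
  proof -
    have fin: "finite (\<Gamma> j \<inter> C0)" by (rule discrete_subgroup_finite_Int_compact[OF disc V0(2)])
    moreover have "0 \<in> \<Gamma> j \<inter> C0" using sub[of j] V0 by (auto simp: is_subgroup_def)
    ultimately have "card (\<Gamma> j \<inter> C0) > 0" by (metis card_gt_0_iff empty_iff)
    then show "0 < N j C0" "N j C0 < top" using fin by (auto simp: N_def of_nat_less_top)
  qed
  have f_C0: "f j C0 = 1" for j unfolding f_def using N_C0[of j] by (simp add: ennreal_divide_self)
  have N_translate: "N j ((\<lambda>x. x + c) ` W) \<le> N j C0" for j c
  proof (cases "\<Gamma> j \<inter> (\<lambda>x. x + c) ` W = {}")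
    case False
    then obtain h w where h: "h \<in> \<Gamma> j" "w \<in> W" "h = w + c" by blast
    have "(\<lambda>x. x - h) ` (\<Gamma> j \<inter> (\<lambda>x. x + c) ` W) \<subseteq> \<Gamma> j \<inter> C0"
    proof (intro subsetI, elim imageE IntE)
      fix y x v assume x: "y = x - h" "x \<in> \<Gamma> j" "x = v + c" "v \<in> W"
      have "- h \<in> \<Gamma> j" using sub[of j] h by (simp add: is_subgroup_def)
      then have "x + - h \<in> \<Gamma> j" using sub[of j] x unfolding is_subgroup_def by blast
      moreover have "x - h = v - w" using x h
        by (simp only: diff_conv_add_uminus minus_add add.assoc add_minus_cancel)
      ultimately show "y \<in> \<Gamma> j \<inter> C0" using x W(3)[OF x(4) h(2)] V0 by auto
    qed
    then show ?thesis unfolding N_def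
      by (intro emeasure_count_space_inj_le[of "\<lambda>x. x - h"]) (auto simp: inj_on_def)
  qed (simp add: N_def)
  have N_cover: "N j (\<Union>c\<in>F. (\<lambda>x. x + c) ` W) \<le> of_nat (card F) * N j C0" if "finite F" for j F
    using that
  proof (induction F)
    case (insert c F)
    have "N j (\<Union>c\<in>insert c F. (\<lambda>x. x + c) ` W) \<le> N j ((\<lambda>x. x + c) ` W) + N j (\<Union>c\<in>F. (\<lambda>x. x + c) ` W)"
      using N_Un by simp
    also have "\<dots> \<le> N j C0 + of_nat (card F) * N j C0"
      by (intro add_mono N_translate insert)
    finally show ?case using insert by (simp add: distrib_right)
  qed (simp add: N_def)
  have f_bound: "\<exists>b::nat. \<forall>j. f j K \<le> of_nat b" if "compact K" for K
  proof -
    obtain F where F: "finite F" "K \<subseteq> (\<Union>c\<in>F. (\<lambda>x. x + c) ` W)"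
      using compact_cover_right_translates[OF \<open>compact K\<close> W(1,2)] .
    have "f j K \<le> of_nat (card F)" for j
    proof -
      have "N j K \<le> of_nat (card F) * N j C0" using N_mono[OF F(2)] N_cover[OF F(1)] by (rule order_trans)
      then have "f j K \<le> of_nat (card F) * N j C0 / N j C0"
        unfolding f_def by (rule divide_right_mono_ennreal)
      also have "\<dots> = of_nat (card F)" using N_C0[of j]
        by (simp add: ennreal_divide_times[symmetric] ennreal_times_divide[symmetric] ennreal_divide_self)
      finally show ?thesis .
    qed
    then show ?thesis by blast
  qed
  obtain F :: "nat filter" and lam :: "'a set \<Rightarrow> ennreal" where F: "F \<noteq> bot" "F \<le> sequentially" and "\<forall>E. ((\<lambda>j. f j E) \<longlongrightarrow> lam E) F"
    using pointwise_cluster_filter[of f] .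
  then have lim: "((\<lambda>j. f j E) \<longlongrightarrow> lam E) F" for E by blast
  have lam_le: "lam A \<le> lam B" if "\<forall>\<^sub>F j in sequentially. N j A \<le> N j B" for A B
  proof (rule tendsto_le[OF F(1) lim lim])
    show "\<forall>\<^sub>F j in F. f j A \<le> f j B"
      using filter_leD[OF F(2) that]
      by (rule eventually_mono) (simp add: f_def divide_right_mono_ennreal)
  qed
  have lim_add: "((\<lambda>j. f j A + f j B) \<longlongrightarrow> lam A + lam B) F" for A B
    by (intro tendsto_add lim)
  interpret compact_content lam
  proof
    show "locally_compact_space (euclidean :: 'a topology)" by (rule loc)
    have "((\<lambda>j. 0) \<longlongrightarrow> lam {}) F" using lim[of "{}"] by (simp add: f_def N_def)
    then show "lam {} = 0" using tendsto_unique[OF F(1) _ tendsto_const] by blast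
    show "lam K \<le> lam L" if "K \<subseteq> L" for K L
      using that by (intro lam_le always_eventually allI N_mono)
    show "lam (K \<union> L) \<le> lam K + lam L" for K L
    proof (rule tendsto_le[OF F(1) lim_add lim], intro always_eventually allI)
      show "f j (K \<union> L) \<le> f j K + f j L" for j
        unfolding f_def add_divide_distrib_ennreal[symmetric]
        by (intro divide_right_mono_ennreal N_Un)
    qed
    show "lam K + lam L \<le> lam (K \<union> L)" if "K \<inter> L = {}" for K L
    proof (rule tendsto_le[OF F(1) lim lim_add], intro always_eventually allI)
      show "f j K + f j L \<le> f j (K \<union> L)" for j
        unfolding f_def add_divide_distrib_ennreal[symmetric] N_disj[OF that] ..
    qed
  qed
  have inj_le: "N j A \<le> N j B"
    if "inj_on h (\<Gamma> j \<inter> A)" "\<And>x. x \<in> \<Gamma> j \<Longrightarrow> x \<in> A \<Longrightarrow> h x \<in> \<Gamma> j \<and> h x \<in> B" for j h A B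
    unfolding N_def using that by (intro emeasure_count_space_inj_le[of h]) auto
  \<comment> \<open>Take \<open>\<gamma> \<in> \<Gamma> j\<close> close to \<open>g\<close>. The translation by \<open>- \<gamma>\<close> preserves \<open>\<Gamma> j\<close> and moves the
    translate of \<open>K\<close> by \<open>g\<close> to within a small distance of \<open>K\<close>, hence into \<open>C\<close>.\<close>
  have left: "lam ((+) g ` K) \<le> lam C"
    if KC: "compact K" "compact C" "open V" "K \<subseteq> V" "V \<subseteq> C" for g K C V
  proof -
    obtain U where U: "open U" "0 \<in> U" "\<And>u k. u \<in> U \<Longrightarrow> k \<in> K \<Longrightarrow> u + k \<in> V"
      using compact_plus_small_nhd[OF KC(1,3,4)] by metis
    have "open ((\<lambda>x. - x + g) -` U)" by (intro open_vimage U continuous_intros)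
    moreover have "g \<in> (\<lambda>x. - x + g) -` U" using U by simp
    ultimately have "\<forall>\<^sub>F j in sequentially. (\<lambda>x. - x + g) -` U \<inter> \<Gamma> j \<noteq> {}"
      by (rule ev_dense)
    then have "\<forall>\<^sub>F j in sequentially. N j ((+) g ` K) \<le> N j C"
    proof (rule eventually_mono)
      fix j assume "(\<lambda>x. - x + g) -` U \<inter> \<Gamma> j \<noteq> {}"
      then obtain \<gamma> where \<gamma>: "- \<gamma> + g \<in> U" "\<gamma> \<in> \<Gamma> j" by blast
      show "N j ((+) g ` K) \<le> N j C"
      proof (rule inj_le[of "(+) (- \<gamma>)"])
        fix x assume x: "x \<in> \<Gamma> j" "x \<in> (+) g ` K"
        then obtain k where k: "k \<in> K" "x = g + k" by blast
        have "- \<gamma> + x \<in> V" using U(3)[OF \<gamma>(1) k(1)] k by (simp add: add.assoc)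
        moreover have "- \<gamma> + x \<in> \<Gamma> j" using \<gamma> x sub[of j] by (simp add: is_subgroup_def)
        ultimately show "- \<gamma> + x \<in> \<Gamma> j \<and> - \<gamma> + x \<in> C" using KC by blast
      qed (simp add: inj_on_def)
    qed
    then show ?thesis by (rule lam_le)
  qed
  have right: "lam ((\<lambda>x. x + g) ` K) \<le> lam C"
    if KC: "compact K" "compact C" "open V" "K \<subseteq> V" "V \<subseteq> C" for g K C V
  proof -
    obtain U where U: "open U" "0 \<in> U" "\<And>u k. u \<in> U \<Longrightarrow> k \<in> K \<Longrightarrow> k + u \<in> V"
      using compact_plus_small_nhd[OF KC(1,3,4)] by metis
    have "open ((\<lambda>x. g + - x) -` U)" by (intro open_vimage U continuous_intros)
    moreover have "g \<in> (\<lambda>x. g + - x) -` U" using U by simp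
    ultimately have "\<forall>\<^sub>F j in sequentially. (\<lambda>x. g + - x) -` U \<inter> \<Gamma> j \<noteq> {}"
      by (rule ev_dense)
    then have "\<forall>\<^sub>F j in sequentially. N j ((\<lambda>x. x + g) ` K) \<le> N j C"
    proof (rule eventually_mono)
      fix j assume "(\<lambda>x. g + - x) -` U \<inter> \<Gamma> j \<noteq> {}"
      then obtain \<gamma> where \<gamma>: "g + - \<gamma> \<in> U" "\<gamma> \<in> \<Gamma> j" by blast
      show "N j ((\<lambda>x. x + g) ` K) \<le> N j C"
      proof (rule inj_le[of "\<lambda>x. x + - \<gamma>"])
        fix x assume x: "x \<in> \<Gamma> j" "x \<in> (\<lambda>x. x + g) ` K"
        then obtain k where k: "k \<in> K" "x = k + g" by blast
        have "x + - \<gamma> \<in> V" using U(3)[OF \<gamma>(1) k(1)] k by (simp only: add.assoc)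
        moreover have "- \<gamma> \<in> \<Gamma> j" using \<gamma> sub[of j] by (simp add: is_subgroup_def)
        then have "x + - \<gamma> \<in> \<Gamma> j" using x sub[of j] unfolding is_subgroup_def by blast
        ultimately show "x + - \<gamma> \<in> \<Gamma> j \<and> x + - \<gamma> \<in> C" using KC by blast
      qed (simp add: inj_on_def)
    qed
    then show ?thesis by (rule lam_le)
  qed
  show ?thesis
  proof (rule that[of content_measure])
    show "sets content_measure = sets borel" by simp
    have "lam C0 = 1" using lim[of C0] tendsto_unique[OF F(1) _ tendsto_const] by (simp add: f_C0)
    then have "1 \<le> emeasure content_measure C0" using emeasure_content_measure_ge[OF V0(2)] by simp
    also have "\<dots> \<le> emeasure content_measure UNIV" by (intro emeasure_mono) auto
    finally show "emeasure content_measure UNIV \<noteq> 0" by auto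
    show "emeasure content_measure K < top" if "compact K" for K
    proof (rule emeasure_content_measure_finite[OF _ that])
      fix L :: "'a set" assume "compact L"
      then obtain b :: nat where "\<forall>j. f j L \<le> of_nat b" using f_bound by blast
      then have "lam L \<le> of_nat b"
        by (intro tendsto_le[OF F(1) tendsto_const lim] always_eventually) auto
      then show "lam L < top" by (rule order.strict_trans1) (rule of_nat_less_top)
    qed
    show "emeasure content_measure ((+) g ` A) = emeasure content_measure A" if "A \<in> sets borel" for g A
      by (rule emeasure_content_measure_invariant[where S = "(+) (- g)", OF _ _ _ _ left left that])
        (auto intro!: continuous_intros simp: add.assoc[symmetric])
    show "emeasure content_measure ((\<lambda>x. x + g) ` A) = emeasure content_measure A" if "A \<in> sets borel" for g A
      by (rule emeasure_content_measure_invariant[where S = "\<lambda>x. x + - g", OF _ _ _ _ right right that])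
        (auto intro!: continuous_intros simp: add.assoc simp del: add_uminus_conv_diff)
  qed
qed

section \<open>Invariant measures on coset spaces\<close>

lemma sets_borel_translate_left:
  fixes A :: "'a::topological_group_add set"
  assumes "A \<in> sets borel" shows "(+) g ` A \<in> sets borel"
proof -
  have "(+) g ` A = (\<lambda>x. - g + x) -` A \<inter> space borel"
  proof (intro set_eqI iffI)
    fix x assume "x \<in> (\<lambda>x. - g + x) -` A \<inter> space borel"
    then show "x \<in> (+) g ` A" by (intro image_eqI[of _ _ "- g + x"]) (simp_all add: add.assoc[symmetric])
  qed auto
  moreover have "(\<lambda>x. - g + x) \<in> borel_measurable borel"
    by (intro borel_measurable_continuous_onI continuous_intros)
  ultimately show ?thesis using assms by (metis measurable_sets)
qed

lemma sets_borel_translate_right: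
  fixes A :: "'a::topological_group_add set"
  assumes "A \<in> sets borel" shows "(\<lambda>x. x + g) ` A \<in> sets borel"
proof -
  have "(\<lambda>x. x + g) ` A = (\<lambda>x. x + - g) -` A \<inter> space borel"
  proof (intro set_eqI iffI)
    fix x assume "x \<in> (\<lambda>x. x + - g) -` A \<inter> space borel"
    then show "x \<in> (\<lambda>x. x + g) ` A" by (intro image_eqI[of _ _ "x + - g"]) simp_all
  qed (auto simp: add.assoc simp del: add_uminus_conv_diff)
  moreover have "(\<lambda>x. x + - g) \<in> borel_measurable borel"
    by (intro borel_measurable_continuous_onI continuous_intros)
  ultimately show ?thesis using assms by (metis measurable_sets)
qed

lemma fundamental_domain_translate_left:
  fixes X :: "'a::topological_group_add set"
  assumes "fundamental_domain H X"
  shows "fundamental_domain H ((+) g ` X)"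
proof -
  have eq: "(\<lambda>x. x + h) ` (+) g ` X = (+) g ` (\<lambda>x. x + h) ` X" for h
    by (simp add: image_image add.assoc)
  have inj: "inj ((+) g)" by (simp add: inj_on_def)
  have "(\<Union>h\<in>H. (+) g ` (\<lambda>x. x + h) ` X) = (+) g ` UNIV"
    using assms unfolding fundamental_domain_def image_UN[symmetric] by simp
  also have "\<dots> = UNIV" by simp
  finally have "(\<Union>h\<in>H. (+) g ` (\<lambda>x. x + h) ` X) = UNIV" .
  moreover have "disjoint_family_on (\<lambda>h. (+) g ` (\<lambda>x. x + h) ` X) H"
    using assms unfolding fundamental_domain_def disjoint_family_on_def
    by (simp add: image_Int[OF inj, symmetric])
  ultimately show ?thesis
    using assms unfolding fundamental_domain_def eq by (simp add: sets_borel_translate_left)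
qed

lemma emeasure_eq_sum_over_fundamental_domain:
  fixes \<mu> :: "'a::topological_group_add measure"
  assumes \<mu>: "sets \<mu> = sets borel" and H: "countable H"
    and X: "fundamental_domain H X" and B: "B \<in> sets borel"
  shows "emeasure \<mu> B = (\<integral>\<^sup>+ h. emeasure \<mu> (B \<inter> (\<lambda>x. x + h) ` X) \<partial>count_space H)"
proof -
  have "B = (\<Union>h\<in>H. B \<inter> (\<lambda>x. x + h) ` X)"
    using X by (simp add: fundamental_domain_def flip: Int_UN_distrib)
  then have "emeasure \<mu> B = emeasure \<mu> (\<Union>h\<in>H. B \<inter> (\<lambda>x. x + h) ` X)" by simp
  also have "\<dots> = (\<integral>\<^sup>+ h. emeasure \<mu> (B \<inter> (\<lambda>x. x + h) ` X) \<partial>count_space H)"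
  proof (rule emeasure_UN_countable[OF _ H])
    show "B \<inter> (\<lambda>x. x + h) ` X \<in> sets \<mu>" for h
      using B X by (auto simp: \<mu> fundamental_domain_def intro!: sets.Int sets_borel_translate_right)
    show "disjoint_family_on (\<lambda>h. B \<inter> (\<lambda>x. x + h) ` X) H"
      using X unfolding fundamental_domain_def disjoint_family_on_def by blast
  qed
  finally show ?thesis .
qed

text \<open>
  Decompose the part of \<open>B\<close> in one domain along the translates of the other and translate the
  pieces back; neither \<open>\<mu>\<close> nor \<open>B\<close> notices, both being right invariant under \<open>H\<close>.
\<close>
lemma emeasure_Int_fundamental_domain_unique:
  fixes \<mu> :: "'a::topological_group_add measure"
  assumes \<mu>: "sets \<mu> = sets borel"
    and inv: "\<And>g A. A \<in> sets borel \<Longrightarrow> emeasure \<mu> ((\<lambda>x. x + g) ` A) = emeasure \<mu> A"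
    and H: "countable H" "is_subgroup H"
    and X: "fundamental_domain H X" and Y: "fundamental_domain H Y"
    and B: "B \<in> sets borel" "\<And>b h. b \<in> B \<Longrightarrow> h \<in> H \<Longrightarrow> b + h \<in> B"
  shows "emeasure \<mu> (B \<inter> X) = emeasure \<mu> (B \<inter> Y)"
proof -
  have X': "X \<in> sets borel" and Y': "Y \<in> sets borel" using X Y by (auto simp: fundamental_domain_def)
  have neg: "- h \<in> H" if "h \<in> H" for h using that H(2) by (simp add: is_subgroup_def)
  have shift: "emeasure \<mu> (B \<inter> X \<inter> (\<lambda>x. x + h) ` Y) = emeasure \<mu> (B \<inter> Y \<inter> (\<lambda>x. x + - h) ` X)"
    if h: "h \<in> H" for h
  proof -
    have "B \<inter> X \<inter> (\<lambda>x. x + h) ` Y = (\<lambda>x. x + h) ` (B \<inter> Y \<inter> (\<lambda>x. x + - h) ` X)"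
    proof (intro set_eqI iffI)
      fix z assume z: "z \<in> B \<inter> X \<inter> (\<lambda>x. x + h) ` Y"
      then obtain y where y: "y \<in> Y" "z = y + h" by blast
      have "y = z + - h" using y by (simp add: add.assoc)
      then have "y \<in> B \<inter> Y \<inter> (\<lambda>x. x + - h) ` X" using z y B(2) neg[OF h] by blast
      then show "z \<in> (\<lambda>x. x + h) ` (B \<inter> Y \<inter> (\<lambda>x. x + - h) ` X)" using y by blast
    next
      fix z assume "z \<in> (\<lambda>x. x + h) ` (B \<inter> Y \<inter> (\<lambda>x. x + - h) ` X)"
      then obtain y x where "z = y + h" "y \<in> B" "y \<in> Y" "y = x + - h" "x \<in> X" by blast
      moreover then have "z = x" by simp
      ultimately show "z \<in> B \<inter> X \<inter> (\<lambda>x. x + h) ` Y" using B(2) h by blast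
    qed
    moreover have "B \<inter> Y \<inter> (\<lambda>x. x + - h) ` X \<in> sets borel"
      using sets_borel_translate_right[OF X', of "- h"] B Y' by blast
    ultimately show ?thesis using inv by metis
  qed
  have bij: "bij_betw uminus H H"
    using neg by (intro bij_betwI[of _ _ _ uminus]) auto
  have "emeasure \<mu> (B \<inter> X) = (\<integral>\<^sup>+ h. emeasure \<mu> (B \<inter> X \<inter> (\<lambda>x. x + h) ` Y) \<partial>count_space H)"
    using B X' by (intro emeasure_eq_sum_over_fundamental_domain \<mu> H Y) blast
  also have "\<dots> = (\<integral>\<^sup>+ h. emeasure \<mu> (B \<inter> Y \<inter> (\<lambda>x. x + - h) ` X) \<partial>count_space H)"
    by (intro nn_integral_cong shift) simp
  also have "\<dots> = (\<integral>\<^sup>+ h. emeasure \<mu> (B \<inter> Y \<inter> (\<lambda>x. x + h) ` X) \<partial>count_space H)"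
    using nn_integral_bij_count_space[OF bij, of "\<lambda>h. emeasure \<mu> (B \<inter> Y \<inter> (\<lambda>x. x + h) ` X)"] .
  also have "\<dots> = emeasure \<mu> (B \<inter> Y)"
    using B Y' by (intro emeasure_eq_sum_over_fundamental_domain[symmetric] \<mu> H X) blast
  finally show ?thesis .
qed

text \<open>
  The measure on \<open>G/H\<close> gives to a set the measure of the part of its preimage in \<open>X\<close>.
  A left translation by \<open>g\<close> amounts to replacing \<open>X\<close> by the fundamental domain \<open>- g + X\<close>, which
  yields the same value. Left invariance is used for the first step, right invariance for the
  second.
\<close>
lemma is_lattice_of_biinvariant_measure:
  fixes H :: "'a::{topological_group_add, second_countable_topology} set" and \<mu> :: "'a measure"
  assumes H: "discrete_subgroup H"
    and X: "fundamental_domain H X"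
    and \<mu>: "sets \<mu> = sets borel" "emeasure \<mu> UNIV \<noteq> 0" "emeasure \<mu> X < top"
    and inv_left: "\<And>g A. A \<in> sets borel \<Longrightarrow> emeasure \<mu> ((+) g ` A) = emeasure \<mu> A"
    and inv_right: "\<And>g A. A \<in> sets borel \<Longrightarrow> emeasure \<mu> ((\<lambda>x. x + g) ` A) = emeasure \<mu> A"
  shows "is_lattice H"
proof -
  have cH: "countable H" by (rule discrete_subgroup_countable[OF H])
  have sub: "is_subgroup H" using H by (simp add: discrete_subgroup_def)
  have X': "X \<in> sets borel" using X by (simp add: fundamental_domain_def)
  define \<pi> where "\<pi> = (\<lambda>g. g +o H)"
  define N where "N = sigma (topspace (coset_space H)) {U. openin (coset_space H) U}"
  have Pow: "{U. openin (coset_space H) U} \<subseteq> Pow (topspace (coset_space H))"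
    by (auto dest: openin_subset)
  have spN: "space N = range \<pi>"
    unfolding N_def space_measure_of[OF Pow] by (simp add: topspace_coset_space \<pi>_def)
  have \<pi>_meas: "\<pi> \<in> measurable borel N"
    unfolding N_def
  proof (rule measurable_measure_of[OF Pow])
    show "\<pi> -` U \<inter> space borel \<in> sets borel" if "U \<in> {U. openin (coset_space H) U}" for U
      using that by (simp add: openin_coset_space \<pi>_def vimage_def)
  qed (simp add: topspace_coset_space \<pi>_def)
  have act: "g +o \<pi> x = \<pi> (g + x)" for g x
    by (simp add: \<pi>_def set_plus_rearrange2)
  have act_meas: "(\<lambda>C. g +o C) \<in> measurable N N" for g
    unfolding N_def
  proof (rule measurable_measure_of[OF Pow])
    show "(\<lambda>C. g +o C) \<in> space (sigma (topspace (coset_space H)) {U. openin (coset_space H) U}) \<rightarrow> topspace (coset_space H)"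
      unfolding N_def[symmetric] spN
      unfolding topspace_coset_space \<pi>_def[symmetric] using act by auto
  next
    fix U assume "U \<in> {U. openin (coset_space H) U}"
    then have "open {x. \<pi> x \<in> U}" by (simp add: openin_coset_space \<pi>_def)
    from open_translate_vimage_left[OF this, of g]
    have "open {x. \<pi> x \<in> (\<lambda>C. g +o C) -` U \<inter> range \<pi>}" by (simp add: act)
    then have "openin (coset_space H) ((\<lambda>C. g +o C) -` U \<inter> range \<pi>)"
      by (simp add: openin_coset_space \<pi>_def)
    then show "(\<lambda>C. g +o C) -` U \<inter> space (sigma (topspace (coset_space H)) {U. openin (coset_space H) U})
        \<in> sets (sigma (topspace (coset_space H)) {U. openin (coset_space H) U})"
      unfolding N_def[symmetric] spN unfolding N_def using Pow
      by (simp add: sets_measure_of sigma_sets.Basic)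
  qed
  define M where "M = distr (density \<mu> (indicator X)) N \<pi>"
  have sM: "sets M = sets N" by (simp add: M_def)
  have \<pi>_meas': "\<pi> \<in> measurable (density \<mu> (indicator X)) N"
    using \<pi>_meas by (simp add: measurable_def sets_eq_imp_space_eq[OF \<mu>(1)] \<mu>(1))
  have pre: "\<pi> -` A \<in> sets borel" if "A \<in> sets N" for A
    using measurable_sets[OF \<pi>_meas that] by simp
  have em: "emeasure M A = emeasure \<mu> (\<pi> -` A \<inter> X)" if "A \<in> sets N" for A
  proof -
    have "emeasure M A = emeasure (density \<mu> (indicator X)) (\<pi> -` A \<inter> space (density \<mu> (indicator X)))"
      unfolding M_def by (rule emeasure_distr[OF \<pi>_meas' that])
    also have "\<dots> = emeasure (density \<mu> (indicator X)) (\<pi> -` A)"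
      by (simp add: sets_eq_imp_space_eq[OF \<mu>(1)])
    also have "\<dots> = emeasure \<mu> (X \<inter> \<pi> -` A)"
      using X' pre[OF that] by (intro emeasure_restricted) (auto simp: \<mu>)
    finally show ?thesis by (simp add: Int_commute)
  qed
  have H_inv: "b + h \<in> \<pi> -` A" if "b \<in> \<pi> -` A" "h \<in> H" for b h A
  proof -
    have "\<pi> (b + h) = \<pi> b"
    proof -
      have "h +o H = H"
      proof (intro set_eqI iffI)
        fix x assume "x \<in> h +o H"
        then show "x \<in> H" using sub that(2) by (auto simp: elt_set_plus_def is_subgroup_def)
      next
        fix x assume "x \<in> H"
        then have "- h + x \<in> H" using sub that(2) by (auto simp: is_subgroup_def)
        then show "x \<in> h +o H" unfolding elt_set_plus_def
          by (intro CollectI bexI[of _ "- h + x"]) (simp_all only: add_minus_cancel)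
      qed
      then show ?thesis unfolding \<pi>_def by (metis set_plus_rearrange2)
    qed
    then show ?thesis using that by simp
  qed
  have "emeasure M ((\<lambda>C. g +o C) ` A) = emeasure M A" if A: "A \<in> sets N" for g A
  proof -
    have AU: "A \<subseteq> range \<pi>" using sets.sets_into_space[OF A] spN by simp
    have cancel: "g +o (- g +o C) = C" "- g +o (g +o C) = C" for C
      by (simp_all add: set_plus_rearrange2 elt_set_plus_def[of 0])
    have "(\<lambda>C. g +o C) ` A = (\<lambda>C. - g +o C) -` A \<inter> space N"
    proof (intro set_eqI iffI)
      fix C assume "C \<in> (\<lambda>C. g +o C) ` A"
      then show "C \<in> (\<lambda>C. - g +o C) -` A \<inter> space N"
        using AU act unfolding spN by (auto simp: cancel)
    next
      fix C assume "C \<in> (\<lambda>C. - g +o C) -` A \<inter> space N"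
      then show "C \<in> (\<lambda>C. g +o C) ` A" by (intro image_eqI[of _ _ "- g +o C"]) (simp_all add: cancel)
    qed
    then have gA: "(\<lambda>C. g +o C) ` A \<in> sets N" using measurable_sets[OF act_meas A] by simp
    have "\<pi> -` (\<lambda>C. g +o C) ` A = (+) g ` (\<pi> -` A)"
    proof (intro set_eqI iffI)
      fix x assume "x \<in> \<pi> -` (\<lambda>C. g +o C) ` A"
      then obtain C where C: "C \<in> A" "\<pi> x = g +o C" by blast
      then have "\<pi> (- g + x) = C" using act[of "- g" x] cancel(2) by simp
      then show "x \<in> (+) g ` (\<pi> -` A)" using C
        by (intro image_eqI[of _ _ "- g + x"]) (simp_all only: add_minus_cancel vimage_eq)
    next
      fix x assume "x \<in> (+) g ` (\<pi> -` A)"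
      then show "x \<in> \<pi> -` (\<lambda>C. g +o C) ` A" using act by auto
    qed
    then have "emeasure M ((\<lambda>C. g +o C) ` A) = emeasure \<mu> ((+) g ` (\<pi> -` A) \<inter> X)"
      using em[OF gA] by simp
    also have "(+) g ` (\<pi> -` A) \<inter> X = (+) g ` (\<pi> -` A \<inter> (+) (- g) ` X)"
    proof -
      have "(+) g ` (+) (- g) ` X = X" by (simp add: image_image add.assoc[symmetric])
      moreover have "inj ((+) g)" by (simp add: inj_on_def)
      ultimately show ?thesis by (simp add: image_Int)
    qed
    also have "emeasure \<mu> \<dots> = emeasure \<mu> (\<pi> -` A \<inter> (+) (- g) ` X)"
      using pre[OF A] sets_borel_translate_left[OF X', of "- g"] by (intro inv_left) blast
    also have "\<dots> = emeasure \<mu> (\<pi> -` A \<inter> X)"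
      by (rule emeasure_Int_fundamental_domain_unique[OF \<mu>(1) inv_right cH sub
          fundamental_domain_translate_left[OF X] X pre[OF A] H_inv])
    also have "\<dots> = emeasure M A" using em[OF A] by simp
    finally show ?thesis .
  qed
  then have inv: "invariant_borel_measure H M"
    unfolding invariant_borel_measure_def using sM by (simp add: N_def)
  have "space M = space N" by (simp add: M_def)
  moreover have "\<pi> -` space N = UNIV" unfolding spN by auto
  ultimately have total: "emeasure M (space M) = emeasure \<mu> X"
    using em[of "space N"] by simp
  \<comment> \<open>A null fundamental domain would make \<open>G\<close>, a countable union of its translates, null.\<close>
  have "emeasure \<mu> X \<noteq> 0"
  proof
    assume 0: "emeasure \<mu> X = 0"
    have "emeasure \<mu> UNIV = (\<integral>\<^sup>+ h. emeasure \<mu> (UNIV \<inter> (\<lambda>x. x + h) ` X) \<partial>count_space H)"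
      by (rule emeasure_eq_sum_over_fundamental_domain[OF \<mu>(1) cH X]) simp
    also have "\<dots> = 0" using inv_right[OF X'] 0 by simp
    finally show False using \<mu>(2) by simp
  qed
  moreover have "finite_measure M" using \<mu>(3) total by (intro finite_measureI) simp
  ultimately show ?thesis unfolding is_lattice_def using H inv total by metis
qed

section \<open>Right invariant metrics\<close>

text \<open>
  The tube lemma gives the estimate for \<open>x \<in> C\<close>. If only \<open>u + x\<close> lies in \<open>C\<close>, exchange the
  roles of the two points, which requires \<open>- u \<in> U\<close>; if neither does, both values equal \<open>c\<close>.
\<close>
lemma uniformly_continuous_of_constant_off_compact:
  fixes f :: "'a::topological_group_add \<Rightarrow> real"
  assumes f: "continuous_on UNIV f" and C: "compact C" "\<And>x. x \<notin> C \<Longrightarrow> f x = c" and e: "0 < e"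
  obtains U where "open U" "0 \<in> U" "\<And>u x. u \<in> U \<Longrightarrow> \<bar>f (u + x) - f x\<bar> < e"
proof -
  let ?W = "{p. \<bar>f (fst p + snd p) - f (snd p)\<bar> < e}"
  have f1: "continuous_on UNIV (\<lambda>p::'a\<times>'a. f (fst p + snd p))"
    by (rule continuous_on_compose2[OF f]) (auto intro!: continuous_intros)
  have f2: "continuous_on UNIV (\<lambda>p::'a\<times>'a. f (snd p))"
    by (rule continuous_on_compose2[OF f]) (auto intro!: continuous_intros)
  have "open ?W"
    by (intro open_Collect_less continuous_intros f1 f2)
  then have "\<exists>U V'. openin euclidean U \<and> openin euclidean V' \<and> 0 \<in> U \<and> C \<subseteq> V' \<and> U \<times> V' \<subseteq> ?W"
    using C e by (intro tube_lemma_right) auto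
  then obtain U V' where U: "open U" "0 \<in> U" "C \<subseteq> V'" "U \<times> V' \<subseteq> ?W" by auto
  have 1: "\<bar>f (u + x) - f x\<bar> < e" if "u \<in> U" "x \<in> C" for u x
    using U that by (auto simp: subset_iff)
  have "\<bar>f (u + x) - f x\<bar> < e" if u: "u \<in> U" "- u \<in> U" for u x
  proof -
    consider "x \<in> C" | "u + x \<in> C" | "x \<notin> C" "u + x \<notin> C" by blast
    then show ?thesis
    proof cases
      case 2
      have "\<bar>f (- u + (u + x)) - f (u + x)\<bar> < e" by (rule 1[OF u(2) 2])
      then show ?thesis by (simp only: minus_add_cancel abs_minus_commute)
    qed (use 1 u e C(2) in auto)
  qed
  moreover have "open (U \<inter> uminus -` U)"
    by (intro open_Int open_vimage U continuous_intros)
  ultimately show ?thesis using U by (intro that[of "U \<inter> uminus -` U"]) auto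
qed

text \<open>
  Sum the Urysohn functions of a countable neighbourhood base with the weights \<open>(1/2) ^ i\<close>. On the
  complement of the \<open>i\<close>-th neighbourhood the sum is at least its \<open>i\<close>-th weight, and as all the
  functions equal \<open>1\<close> off one compact set, it is constant there.
\<close>
lemma ex_peak_function:
  fixes x0 :: "'a::{t2_space, first_countable_topology}"
  assumes loc: "locally_compact_space (euclidean :: 'a topology)"
  obtains f :: "'a \<Rightarrow> real" and C :: "'a set" and c where
    "continuous_on UNIV f" "f x0 = 0" "\<And>x. 0 \<le> f x" "\<And>x. f x \<le> 2"
    "compact C" "\<And>x. x \<notin> C \<Longrightarrow> f x = c"
    "\<And>S. open S \<Longrightarrow> x0 \<in> S \<Longrightarrow> \<exists>e>0. \<forall>x. f x < e \<longrightarrow> x \<in> S"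
proof -
  obtain V0 C0 :: "'a set" where V0: "open V0" "compact C0" "{x0} \<subseteq> V0" "V0 \<subseteq> C0" "C0 \<subseteq> UNIV"
    using compact_nhd_of_compact[OF loc compact_sing[of x0] open_UNIV subset_UNIV] .
  obtain A :: "nat \<Rightarrow> 'a set" where A: "\<And>i. open (A i)" "\<And>i. x0 \<in> A i"
    "\<And>S. open S \<Longrightarrow> x0 \<in> S \<Longrightarrow> eventually (\<lambda>i. A i \<subseteq> S) sequentially"
    using countable_basis_at_decseq[of x0] by metis
  have "Hausdorff_space (euclidean :: 'a topology)"
    unfolding Hausdorff_space_def by (auto simp: disjnt_def separation_t2)
  then have "completely_regular_space (euclidean :: 'a topology)"
    using loc locally_compact_Hausdorff_imp_regular_space
      locally_compact_regular_imp_completely_regular_space by blast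
  then have "\<exists>f. continuous_on UNIV f \<and> (\<forall>x. f x \<in> {0..1}) \<and> f x0 = 0 \<and> (\<forall>x. x \<notin> A i \<inter> V0 \<longrightarrow> f x = (1::real))" for i
  proof -
    have "closedin euclidean (- (A i \<inter> V0))" "x0 \<in> topspace euclidean - (- (A i \<inter> V0))"
      using A V0 by auto
    with \<open>completely_regular_space euclidean\<close> obtain f :: "'a \<Rightarrow> real"
      where f: "continuous_map euclidean (top_of_set {0..1}) f" "f x0 = 0" "f ` (- (A i \<inter> V0)) \<subseteq> {1}"
      unfolding completely_regular_space_def by metis
    have "continuous_on UNIV f" "\<forall>x. f x \<in> {0..1}"
      using f(1) by (auto simp: continuous_map_in_subtopology image_subset_iff Pi_iff)
    then show ?thesis using f by (intro exI[of _ f]) auto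
  qed
  then obtain \<phi> :: "nat \<Rightarrow> 'a \<Rightarrow> real" where \<phi>: "\<And>i. continuous_on UNIV (\<phi> i)" "\<And>i x. \<phi> i x \<in> {0..1}"
    "\<And>i. \<phi> i x0 = 0" "\<And>i x. x \<notin> A i \<inter> V0 \<Longrightarrow> \<phi> i x = 1" by metis
  define f where "f x = (\<Sum>i. (1/2)^i * \<phi> i x)" for x
  have geo: "(\<lambda>i. (1/2::real)^i) sums 2" using geometric_sums[of "1/2::real"] by simp
  have geo_suminf: "(\<Sum>i. (1/2::real)^i) = 2" by (rule sums_unique[OF geo, symmetric])
  have b: "0 \<le> (1/2)^i * \<phi> i x" "(1/2)^i * \<phi> i x \<le> (1/2)^i" for i x
    using \<phi>(2)[of i x] by (auto intro: mult_left_le)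
  have summ: "summable (\<lambda>i. (1/2)^i * \<phi> i x)" for x
    by (rule summable_comparison_test'[OF sums_summable[OF geo], of 0]) (use b in auto)
  show ?thesis
  proof (rule that[of f C0 2])
    have "uniform_limit UNIV (\<lambda>n x. \<Sum>i<n. (1/2)^i * \<phi> i x) f sequentially"
      unfolding f_def by (rule Weierstrass_m_test[OF _ sums_summable[OF geo]]) (use b in auto)
    moreover have "\<forall>\<^sub>F n in sequentially. continuous_on UNIV (\<lambda>x. \<Sum>i<n. (1/2)^i * \<phi> i x)"
      by (intro always_eventually allI continuous_intros \<phi>)
    ultimately show "continuous_on UNIV f" by (intro uniform_limit_theorem) auto
    show "f x0 = 0" by (simp add: f_def \<phi>)
    show "0 \<le> f x" for x unfolding f_def by (intro suminf_nonneg summ b)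
    show "f x \<le> 2" for x
    proof -
      have "f x \<le> (\<Sum>i. (1/2)^i)"
        unfolding f_def by (intro suminf_le summ sums_summable[OF geo] b)
      then show ?thesis by (simp only: geo_suminf)
    qed
    show "compact C0" by (rule V0)
    show "f x = 2" if "x \<notin> C0" for x
    proof -
      have "\<phi> i x = 1" for i using \<phi>(4) that V0 by blast
      then show ?thesis unfolding f_def by (simp only: geo_suminf mult_1_right)
    qed
    show "\<exists>e>0. \<forall>x. f x < e \<longrightarrow> x \<in> S" if S: "open S" "x0 \<in> S" for S
    proof -
      obtain i where i: "A i \<subseteq> S" using A(3)[OF S] by (auto simp: eventually_sequentially)
      have "x \<in> S" if x: "f x < (1/2)^i" for x
      proof (rule ccontr)
        assume "x \<notin> S"
        then have "\<phi> i x = 1" using i \<phi>(4) by blast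
        moreover have "(1/2)^i * \<phi> i x \<le> f x" unfolding f_def
          using sum_le_suminf[OF summ[of x], of "{i}"] b by simp
        ultimately show False using x by simp
      qed
      then show ?thesis by (intro exI[of _ "(1/2)^i"]) auto
    qed
  qed
qed

text \<open>
  With \<open>f\<close> peaking at the identity, \<open>d x y\<close> is the uniform distance between the
  functions \<open>g \<mapsto> f (x + g)\<close> and \<open>g \<mapsto> f (y + g)\<close>. Uniform continuity of \<open>f\<close> makes \<open>d\<close>
  continuous, and \<open>f (x - y) \<le> d x y\<close> makes its balls small.
\<close>
lemma ex_right_invariant_metric:
  assumes loc: "locally_compact_space (euclidean :: 'a topology)"
  obtains d :: "'a::{topological_group_add, t2_space, first_countable_topology} \<Rightarrow> 'a \<Rightarrow> real" where "Metric_space UNIV d" "Metric_space.mtopology UNIV d = euclidean"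
    "\<And>x y g. d (x + g) (y + g) = d x y"
proof -
  obtain f :: "'a \<Rightarrow> real" and C c where f: "continuous_on UNIV f" "f 0 = 0" "\<And>x. 0 \<le> f x" "\<And>x. f x \<le> 2"
    "compact C" "\<And>x. x \<notin> C \<Longrightarrow> f x = c"
    "\<And>S. open S \<Longrightarrow> 0 \<in> S \<Longrightarrow> \<exists>e>0. \<forall>x. f x < e \<longrightarrow> x \<in> S"
    using ex_peak_function[OF loc, of 0] by metis
  define d where "d x y = (SUP g. \<bar>f (x + g) - f (y + g)\<bar>)" for x y
  have "\<bar>f x - f y\<bar> \<le> 2" for x y using f(3)[of x] f(4)[of x] f(3)[of y] f(4)[of y] by (simp add: abs_le_iff)
  then have bdd: "bdd_above (range (\<lambda>g. \<bar>f (x + g) - f (y + g)\<bar>))" for x y by (intro bdd_aboveI[of _ 2]) auto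
  have upper: "\<bar>f (x + g) - f (y + g)\<bar> \<le> d x y" for x y g
    unfolding d_def by (rule cSUP_upper[OF _ bdd]) simp
  have least: "d x y \<le> b" if "\<And>g. \<bar>f (x + g) - f (y + g)\<bar> \<le> b" for x y b
    unfolding d_def by (rule cSUP_least) (use that in auto)
  have peak: "f (x - y) \<le> d x y" for x y
    using upper[of x "- y" y] f(2) f(3)[of "x - y"] by simp
  have nonneg: "0 \<le> d x y" for x y using peak[of x y] f(3)[of "x - y"] by linarith
  have sym: "d x y = d y x" for x y unfolding d_def by (simp add: abs_minus_commute)
  have inv: "d (x + g) (y + g) = d x y" for x y g
  proof (rule antisym)
    show "d (x + g) (y + g) \<le> d x y"
      by (rule least) (simp add: add.assoc upper)
    show "d x y \<le> d (x + g) (y + g)"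
    proof (rule least)
      fix h show "\<bar>f (x + h) - f (y + h)\<bar> \<le> d (x + g) (y + g)"
        using upper[of "x + g" "- g + h" "y + g"] by (simp only: add.assoc add_minus_cancel)
    qed
  qed
  have zero: "d x y = 0 \<longleftrightarrow> x = y" for x y
  proof
    assume "d x y = 0"
    then have "f (x - y) = 0" using peak[of x y] f(3)[of "x - y"] by simp
    show "x = y"
    proof (rule ccontr)
      assume "x \<noteq> y"
      then have "open (- {x - y})" "0 \<in> - {x - y}" by auto
      from f(7)[OF this] obtain e where "e > 0" "\<forall>z. f z < e \<longrightarrow> z \<in> - {x - y}" by blast
      then have "x - y \<in> - {x - y}" using \<open>f (x - y) = 0\<close> by metis
      then show False by simp
    qed
  next
    assume "x = y"
    then have "d x y \<le> 0" by (intro least) simp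
    then show "d x y = 0" using nonneg[of x y] by simp
  qed
  have tri: "d x z \<le> d x y + d y z" for x y z
  proof (rule least)
    fix g show "\<bar>f (x + g) - f (z + g)\<bar> \<le> d x y + d y z"
      using upper[of x g y] upper[of y g z] by linarith
  qed
  interpret Metric_space UNIV d
    by unfold_locales (rule nonneg sym zero tri)+
  have "openin mtopology S = openin euclidean S" for S
  proof
    assume S: "openin mtopology S"
    have "\<exists>T. open T \<and> x \<in> T \<and> T \<subseteq> S" if "x \<in> S" for x
    proof -
      obtain r where r: "r > 0" "mball x r \<subseteq> S" using S \<open>x \<in> S\<close> by (auto simp: openin_mtopology)
      have "0 < r / 2" using r by simp
      obtain U where U: "open U" "0 \<in> U" "\<And>u z. u \<in> U \<Longrightarrow> \<bar>f (u + z) - f z\<bar> < r / 2"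
        using uniformly_continuous_of_constant_off_compact[OF f(1,5,6) \<open>0 < r / 2\<close>] by metis
      have "y \<in> S" if y: "y + - x \<in> U" for y
      proof -
        have "d y x \<le> r / 2"
        proof (rule least)
          fix g
          have "\<bar>f (y + - x + (x + g)) - f (x + g)\<bar> < r / 2" by (rule U(3)[OF y])
          then show "\<bar>f (y + g) - f (x + g)\<bar> \<le> r / 2"
            by (simp only: add.assoc minus_add_cancel less_imp_le)
        qed
        then have "y \<in> mball x r" using r sym[of x y] by simp
        then show ?thesis using r by blast
      qed
      then have "{y. y + - x \<in> U} \<subseteq> S" by blast
      moreover have "open {y. y + - x \<in> U}" by (rule open_translate_vimage_right[OF U(1)])
      moreover have "x \<in> {y. y + - x \<in> U}" using U by simp
      ultimately show ?thesis by blast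
    qed
    then show "openin euclidean S" by (subst open_openin[symmetric], subst open_subopen) auto
  next
    assume "openin euclidean S"
    then have S: "open S" by simp
    have "\<exists>r>0. mball x r \<subseteq> S" if "x \<in> S" for x
    proof -
      have "open {z. z + x \<in> S}" "0 \<in> {z. z + x \<in> S}"
        using open_translate_vimage_right[OF S] that by auto
      from f(7)[OF this] obtain e where e: "e > 0" "\<And>z. f z < e \<Longrightarrow> z + x \<in> S" by auto
      have "y \<in> S" if "y \<in> mball x e" for y
      proof -
        have "f (y - x) < e" using that peak[of y x] sym[of x y] by simp
        from e(2)[OF this] show ?thesis by simp
      qed
      then show ?thesis using e by blast
    qed
    then show "openin mtopology S" by (auto simp: openin_mtopology)
  qed
  then have "mtopology = euclidean" by (simp add: topology_eq)
  then show ?thesis using that Metric_space_axioms inv by blast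
qed

section \<open>The four approximation properties\<close>

text \<open>
  The basic neighbourhoods \<open>{F. closed F \<and> F \<inter> K = {}}\<close> contain \<^term>\<open>UNIV\<close> only for
  \<open>K = {}\<close>, so near the full group only the conditions of meeting an open set matter.
\<close>
lemma limitin_chabauty_fell_UNIV_iff:
  fixes \<Gamma> :: "nat \<Rightarrow> 'a::topological_space set"
  assumes closed: "\<And>j. closed (\<Gamma> j)"
  shows "limitin chabauty_fell \<Gamma> UNIV sequentially \<longleftrightarrow>
    (\<forall>U. open U \<and> U \<noteq> {} \<longrightarrow> (\<exists>j0. \<forall>j\<ge>j0. U \<inter> \<Gamma> j \<noteq> {}))"
proof
  assume lim: "limitin chabauty_fell \<Gamma> UNIV sequentially"
  show "\<forall>U. open U \<and> U \<noteq> {} \<longrightarrow> (\<exists>j0. \<forall>j\<ge>j0. U \<inter> \<Gamma> j \<noteq> {})"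
  proof (intro allI impI)
    fix U :: "'a set" assume U: "open U \<and> U \<noteq> {}"
    have "openin chabauty_fell {F. closed F \<and> F \<inter> U \<noteq> {}}"
      unfolding chabauty_fell_def using U by (intro topology_generated_by_Basis) blast
    moreover have "UNIV \<in> {F. closed F \<and> F \<inter> U \<noteq> {}}" using U by simp
    ultimately have "\<forall>\<^sub>F j in sequentially. \<Gamma> j \<in> {F. closed F \<and> F \<inter> U \<noteq> {}}"
      using lim unfolding limitin_def by blast
    then show "\<exists>j0. \<forall>j\<ge>j0. U \<inter> \<Gamma> j \<noteq> {}"
      unfolding eventually_sequentially by blast
  qed
next
  assume dense: "\<forall>U. open U \<and> U \<noteq> {} \<longrightarrow> (\<exists>j0. \<forall>j\<ge>j0. U \<inter> \<Gamma> j \<noteq> {})"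
  show "limitin chabauty_fell \<Gamma> UNIV sequentially"
    unfolding limitin_def
  proof (intro conjI allI impI)
    show "UNIV \<in> topspace (chabauty_fell :: 'a set topology)" by (simp add: topspace_chabauty_fell)
    fix \<U> :: "'a set set" assume U: "openin chabauty_fell \<U> \<and> UNIV \<in> \<U>"
    then have "generate_topology_on ({{F. closed F \<and> F \<inter> K = {}} |K. compact K} \<union> {{F. closed F \<and> F \<inter> U \<noteq> {}} |U. open U}) \<U>"
      by (simp add: chabauty_fell_def openin_topology_generated_by_iff)
    then have "UNIV \<in> \<U> \<longrightarrow> (\<forall>\<^sub>F j in sequentially. \<Gamma> j \<in> \<U>)"
    proof (induction rule: generate_topology_on.induct)
      case (Int a b)
      then show ?case by (auto intro: eventually_conj)
    next
      case (UN K)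
      show ?case
      proof
        assume "UNIV \<in> \<Union>K"
        then obtain k where "k \<in> K" "UNIV \<in> k" by blast
        with UN have "\<forall>\<^sub>F j in sequentially. \<Gamma> j \<in> k" by blast
        then show "\<forall>\<^sub>F j in sequentially. \<Gamma> j \<in> \<Union>K"
          by (rule eventually_mono) (use \<open>k \<in> K\<close> in blast)
      qed
    next
      case (Basis s)
      then consider K where "s = {F. closed F \<and> F \<inter> K = {}}" | U where "s = {F. closed F \<and> F \<inter> U \<noteq> {}}" "open U"
        by blast
      then show ?case
      proof cases
        case 1
        then show ?thesis using closed by auto
      next
        case 2
        show ?thesis
        proof
          assume "UNIV \<in> s"
          then have "U \<noteq> {}" using 2 by auto
          then obtain j0 where "\<forall>j\<ge>j0. U \<inter> \<Gamma> j \<noteq> {}" using dense 2 by blast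
          then show "\<forall>\<^sub>F j in sequentially. \<Gamma> j \<in> s"
            using closed by (auto simp: 2 eventually_sequentially Int_commute)
        qed
      qed
    qed simp
    then show "\<forall>\<^sub>F j in sequentially. \<Gamma> j \<in> \<U>" using U by blast
  qed
qed

lemma is_lattice_imp_discrete: "is_lattice H \<Longrightarrow> discrete_subgroup H"
  by (simp add: is_lattice_def)

lemma is_lattice_imp_closed: "is_lattice (H :: 'a::{topological_group_add, t2_space} set) \<Longrightarrow> closed H"
  by (intro discrete_subgroup_closed is_lattice_imp_discrete)

lemma ALS_imp_ADS: "ALS TYPE('a::{topological_group_add, t2_space}) \<Longrightarrow> ADS TYPE('a)"
  unfolding ALS_def ADS_def
  by (metis is_lattice_imp_discrete is_lattice_imp_closed limitin_chabauty_fell_UNIV_iff)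

lemma uniformly_ALS_imp_ADS:
  assumes "uniformly_ALS TYPE('a::topological_group_add)"
  shows "ADS TYPE('a)"
proof -
  obtain \<Gamma> :: "nat \<Rightarrow> 'a set" and d :: "'a \<Rightarrow> 'a \<Rightarrow> real" where
    lat: "\<forall>j. is_lattice (\<Gamma> j)" and d: "Metric_space UNIV d" "Metric_space.mtopology UNIV d = euclidean"
    and unif: "\<forall>e>0. \<exists>j0. \<forall>j\<ge>j0. \<forall>s. \<exists>\<gamma>\<in>\<Gamma> j. d s \<gamma> < e"
    using assms unfolding uniformly_ALS_def by blast
  interpret Metric_space UNIV d by (rule d(1))
  have "\<exists>j0. \<forall>j\<ge>j0. U \<inter> \<Gamma> j \<noteq> {}" if "open U" "U \<noteq> {}" for U
  proof -
    obtain s where s: "s \<in> U" using \<open>U \<noteq> {}\<close> by blast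
    have "openin mtopology U" using d(2) that by simp
    then obtain e where e: "e > 0" "mball s e \<subseteq> U" using s by (auto simp: openin_mtopology)
    obtain j0 where j0: "\<forall>j\<ge>j0. \<forall>s. \<exists>\<gamma>\<in>\<Gamma> j. d s \<gamma> < e" using unif e(1) by blast
    have "U \<inter> \<Gamma> j \<noteq> {}" if "j \<ge> j0" for j
    proof -
      obtain \<gamma> where "\<gamma> \<in> \<Gamma> j" "d s \<gamma> < e" using j0 \<open>j \<ge> j0\<close> by blast
      then have "\<gamma> \<in> U \<inter> \<Gamma> j" using e by auto
      then show ?thesis by blast
    qed
    then show ?thesis by blast
  qed
  then show ?thesis unfolding ADS_def using lat is_lattice_imp_discrete by blast
qed

text \<open>
  Every \<open>s\<close> is \<open>x + h\<close> with \<open>x\<close> in the fundamental domain and \<open>h\<close> in the subgroup; if \<open>x\<close> is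
  close to \<open>0\<close>, then \<open>h = - x + s\<close> is close to \<open>s\<close>.
\<close>
lemma dense_of_small_fundamental_domains:
  fixes \<Gamma> X :: "nat \<Rightarrow> 'a::topological_group_add set"
  assumes X: "\<And>j. fundamental_domain (\<Gamma> j) (X j)"
    and small: "\<And>V. open V \<Longrightarrow> 0 \<in> V \<Longrightarrow> \<exists>j0. \<forall>j\<ge>j0. X j \<subseteq> V"
    and U: "open U" "U \<noteq> {}"
  shows "\<exists>j0. \<forall>j\<ge>j0. U \<inter> \<Gamma> j \<noteq> {}"
proof -
  obtain s where s: "s \<in> U" using U by blast
  define V where "V = (\<lambda>x. - x + s) -` U"
  have "open V" unfolding V_def by (intro open_vimage U continuous_intros)
  moreover have "0 \<in> V" using s by (simp add: V_def)
  ultimately obtain j0 where j0: "\<forall>j\<ge>j0. X j \<subseteq> V" using small by blast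
  have "U \<inter> \<Gamma> j \<noteq> {}" if "j \<ge> j0" for j
  proof -
    have "s \<in> (\<Union>h\<in>\<Gamma> j. (\<lambda>x. x + h) ` X j)" using X[of j] by (simp add: fundamental_domain_def)
    then obtain x h where x: "x \<in> X j" "h \<in> \<Gamma> j" "s = x + h" by blast
    have "- x + s \<in> U" using j0 that x(1) unfolding V_def by blast
    then have "h \<in> U" unfolding x(3) by (simp only: minus_add_cancel)
    then show ?thesis using x by blast
  qed
  then show ?thesis by blast
qed

lemma ALSS_imp_ADS:
  assumes "ALSS TYPE('a::topological_group_add)"
  shows "ADS TYPE('a)"
proof -
  obtain \<Gamma> X :: "nat \<Rightarrow> 'a set" where lat: "\<forall>j. is_lattice (\<Gamma> j)"
    and X: "\<forall>j. fundamental_domain (\<Gamma> j) (X j)"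
    and small: "\<forall>V. 0 \<in> interior V \<longrightarrow> (\<exists>j0. \<forall>j\<ge>j0. X j \<subseteq> V)"
    using assms unfolding ALSS_def by blast
  have "\<exists>j0. \<forall>j\<ge>j0. X j \<subseteq> V" if "open V" "0 \<in> V" for V
    using small that by (simp add: interior_open)
  from dense_of_small_fundamental_domains[of \<Gamma>, OF _ this] X
  show ?thesis unfolding ADS_def using lat is_lattice_imp_discrete by blast
qed

text \<open>
  The approximating lattices are members of the given sequence of discrete subgroups, one
  chosen for each set of a countable neighbourhood base at the identity. These sets are shrunk to
  lie in a fixed compact set, so that the fundamental domains have finite measure.
\<close>
lemma ADS_imp_lattices_with_small_fundamental_domains:
  assumes loc: "locally_compact_space (euclidean :: 'a topology)"
    and cg: "compactly_generated TYPE('a)" and ads: "ADS TYPE('a)"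
  obtains \<Gamma> X :: "nat \<Rightarrow> 'a::{topological_group_add, t2_space, second_countable_topology} set" where
    "\<And>n. is_lattice (\<Gamma> n)" "\<And>n. fundamental_domain (\<Gamma> n) (X n)"
    "\<And>U. open U \<Longrightarrow> 0 \<in> U \<Longrightarrow> \<exists>n0. \<forall>n\<ge>n0. X n \<subseteq> U"
proof -
  obtain \<Delta> :: "nat \<Rightarrow> 'a set" where \<Delta>: "\<forall>j. discrete_subgroup (\<Delta> j)"
    "\<forall>U. open U \<and> U \<noteq> {} \<longrightarrow> (\<exists>j0. \<forall>j\<ge>j0. U \<inter> \<Delta> j \<noteq> {})"
    using ads unfolding ADS_def by blast
  have disc: "discrete_subgroup (\<Delta> j)" for j using \<Delta>(1) by blast
  have dense: "\<exists>j0. \<forall>j\<ge>j0. U \<inter> \<Delta> j \<noteq> {}" if "open U" "U \<noteq> {}" for U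
    using \<Delta>(2) that by blast
  obtain K :: "'a set" where K: "compact K" "is_subgroup hull K = UNIV"
    using cg unfolding compactly_generated_def by blast
  obtain V0 C0 :: "'a set" where V0: "open V0" "compact C0" "{0} \<subseteq> V0" "V0 \<subseteq> C0" "C0 \<subseteq> UNIV"
    using compact_nhd_of_compact[OF loc compact_sing[of 0] open_UNIV subset_UNIV] .
  obtain A :: "nat \<Rightarrow> 'a set" where A: "\<And>i. open (A i)" "\<And>i. 0 \<in> A i"
    "\<And>S. open S \<Longrightarrow> 0 \<in> S \<Longrightarrow> eventually (\<lambda>i. A i \<subseteq> S) sequentially"
    using countable_basis_at_decseq[of 0] by metis
  have sub: "is_subgroup (\<Delta> j)" for j using disc by (simp add: discrete_subgroup_def)
  have "\<exists>j. \<forall>s. \<exists>x\<in>A n \<inter> V0. \<exists>\<gamma>\<in>\<Delta> j. s = x + \<gamma>" for n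
  proof -
    have "open (A n \<inter> V0)" "0 \<in> A n \<inter> V0" "A n \<inter> V0 \<subseteq> C0" using A V0 by auto
    from eventually_small_nhd_plus_subgroup[OF sub dense K this V0(2)]
    show ?thesis by (rule eventually_happens'[OF sequentially_bot])
  qed
  then obtain j where j: "\<And>n s. \<exists>x\<in>A n \<inter> V0. \<exists>\<gamma>\<in>\<Delta> (j n). s = x + \<gamma>" by metis
  have "\<exists>X. fundamental_domain (\<Delta> (j n)) X \<and> X \<subseteq> A n \<inter> V0" for n
    using ex_fundamental_domain[OF disc _ j] A V0 by (metis open_Int)
  then obtain X where X: "\<And>n. fundamental_domain (\<Delta> (j n)) (X n)" "\<And>n. X n \<subseteq> A n \<inter> V0" by metis
  have lat: "is_lattice (\<Delta> (j n))" for n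
  proof (rule ex_biinvariant_measure[OF loc disc dense])
    fix \<mu> :: "'a measure"
    assume \<mu>: "sets \<mu> = sets borel" "emeasure \<mu> UNIV \<noteq> 0"
      "\<And>K. compact K \<Longrightarrow> emeasure \<mu> K < top"
      "\<And>g A. A \<in> sets borel \<Longrightarrow> emeasure \<mu> ((+) g ` A) = emeasure \<mu> A"
      "\<And>g A. A \<in> sets borel \<Longrightarrow> emeasure \<mu> ((\<lambda>x. x + g) ` A) = emeasure \<mu> A"
    have "emeasure \<mu> (X n) \<le> emeasure \<mu> C0"
      using X(2)[of n] V0 by (intro emeasure_mono) (auto simp: \<mu>(1) borel_compact)
    also have "\<dots> < top" by (rule \<mu>(3)[OF V0(2)])
    finally show "is_lattice (\<Delta> (j n))"
      by (intro is_lattice_of_biinvariant_measure[OF disc X(1) \<mu>(1,2) _ \<mu>(4,5)])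
  qed
  have small: "\<exists>n0. \<forall>n\<ge>n0. X n \<subseteq> U" if "open U" "0 \<in> U" for U
    using A(3)[OF that] X(2) unfolding eventually_sequentially by blast
  show ?thesis by (rule that[of "\<lambda>n. \<Delta> (j n)" X]) (use lat X small in auto)
qed

theorem theorem5p13:
  assumes "locally_compact_space
             (euclidean :: 'a::{topological_group_add, t2_space, second_countable_topology} topology)"
    and "compactly_generated TYPE('a)"
  shows "(ADS TYPE('a) \<longleftrightarrow> ALS TYPE('a)) \<and>
         (ALS TYPE('a) \<longleftrightarrow> uniformly_ALS TYPE('a)) \<and>
         (uniformly_ALS TYPE('a) \<longleftrightarrow> ALSS TYPE('a))"
proof -
  have "ALS TYPE('a) \<and> uniformly_ALS TYPE('a) \<and> ALSS TYPE('a)" if ads: "ADS TYPE('a)"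
  proof (intro conjI)
    obtain \<Gamma> X :: "nat \<Rightarrow> 'a set" where lat: "\<And>n. is_lattice (\<Gamma> n)"
      and X: "\<And>n. fundamental_domain (\<Gamma> n) (X n)"
      and small: "\<And>U. open U \<Longrightarrow> 0 \<in> U \<Longrightarrow> \<exists>n0. \<forall>n\<ge>n0. X n \<subseteq> U"
      using ADS_imp_lattices_with_small_fundamental_domains[OF assms ads] by metis
    have "\<exists>j0. \<forall>j\<ge>j0. X j \<subseteq> V" if "0 \<in> interior V" for V
      using small[OF open_interior that] interior_subset[of V] by blast
    then show "ALSS TYPE('a)" unfolding ALSS_def using lat X by blast
    have "limitin chabauty_fell \<Gamma> UNIV sequentially"
      using dense_of_small_fundamental_domains[OF X small] lat
      by (simp add: limitin_chabauty_fell_UNIV_iff is_lattice_imp_closed)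
    then show "ALS TYPE('a)" unfolding ALS_def using lat by blast
    obtain d :: "'a \<Rightarrow> 'a \<Rightarrow> real" where d: "Metric_space UNIV d" "Metric_space.mtopology UNIV d = euclidean"
      "\<And>x y g. d (x + g) (y + g) = d x y"
      using ex_right_invariant_metric[OF assms(1)] by metis
    interpret Metric_space UNIV d by (rule d(1))
    have "\<exists>j0. \<forall>j\<ge>j0. \<forall>s. \<exists>\<gamma>\<in>\<Gamma> j. d s \<gamma> < e" if "e > 0" for e
    proof -
      have "openin mtopology (mball 0 e)" by (rule openin_mball)
      then have "open (mball 0 e)" using d(2) by simp
      moreover have "0 \<in> mball 0 e" using that by simp
      ultimately obtain j0 where j0: "\<forall>j\<ge>j0. X j \<subseteq> mball 0 e" using small by blast
      have "\<exists>\<gamma>\<in>\<Gamma> j. d s \<gamma> < e" if "j \<ge> j0" for j s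
      proof -
        have "s \<in> (\<Union>h\<in>\<Gamma> j. (\<lambda>x. x + h) ` X j)" using X by (simp add: fundamental_domain_def)
        then obtain x h where x: "x \<in> X j" "h \<in> \<Gamma> j" "s = x + h" by blast
        have "x \<in> mball 0 e" using j0 that x(1) by blast
        then have "d x 0 < e" by (simp add: commute[of x 0])
        moreover have "d s h = d x 0" using d(3)[of x h 0] x(3) by simp
        ultimately have "d s h < e" by simp
        then show ?thesis using x by blast
      qed
      then show ?thesis by blast
    qed
    then show "uniformly_ALS TYPE('a)" unfolding uniformly_ALS_def using lat d by blast
  qed
  then show ?thesis
    using ALS_imp_ADS uniformly_ALS_imp_ADS ALSS_imp_ADS by blast
qed

end
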